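(* Let $\nu,\alpha,\beta\in\mathbb{R}$ with $\alpha>-1-2\nu$ and $\beta>-1$. Let $f(z)=z^{\nu}F(z)$ belong to the class $\mathcal{B}$ (defined in the context), let $\lambda_n$, $n=1,2,\dots$, be the zeros of $F$, and suppose that $$\int_0^1 f(\lambda_n t)f(\lambda_m t)\,t^{\alpha}(1-t)^{\beta}\,dt=0\qquad\text{whenever } n\neq m .$$ Put $a=F'(0)$ and $\mu=2\nu+\alpha+1$. Then there is a constant $C$ such that $$f(z)=C\,z^{\nu}\sum_{n=0}^{\infty}a_n z^n,\qquad a_n=\frac{(a(\beta+1))^n}{\Gamma(\mu+n)}\prod_{j=1}^{n}\frac{(\mu)_j}{(\mu+\beta+1)_j-(\mu)_j},\quad n=0,1,\dots,$$ where the empty product equals $1$. Moreover, the series $\sum_{n=0}^\infty a_n z^n$ represents an entire function of order $\rho=\frac{1}{\beta+2}<1$. In particular, when $\beta=0$, one obtains the solutions in terms of Bessel functions $$f(z)=C'\,z^{-\alpha/2}J_{\mu-1}\!\left(c\,z^{1/2}\right),\qquad c^2=-4a\mu,$$ for some constant $C'$.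
   Context: Class $\mathcal{B}$: let $\nu,\alpha\in\mathbb{R}$ with $2\nu+\alpha>-1$. A function $f(z)=z^{\nu}F(z)$ is said to belong to the class $\mathcal{B}$ if $F$ is an entire function with $F(0)=1$, of order less than one or of order one and minimal type, whose zeros $\lambda_n$, $n=1,2,\dots$, are real (not necessarily positive) and satisfy $\sum_n|\lambda_n|^{-1}<\infty$. Notation: $\Gamma$ is Euler's Gamma function, $(b)_j=\Gamma(b+j)/\Gamma(b)$ is the Pochhammer symbol, and $J_{\mu-1}$ is the Bessel function of the first kind. Powers $z^{\nu}$, $z^{1/2}$, etc. are taken with consistent branches, so that in the Bessel formula $z^{-\alpha/2}(z^{1/2})^{\mu-1}=z^{\nu}$. *)

theory Defs
  imports "HOL-Complex_Analysis.Complex_Analysis"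
begin

definition max_modulus :: "(complex \<Rightarrow> complex) \<Rightarrow> real \<Rightarrow> real" where
  "max_modulus F r = (SUP z\<in>sphere 0 r. norm (F z))"

definition entire_order :: "(complex \<Rightarrow> complex) \<Rightarrow> ereal" where
  "entire_order F = Limsup at_top (\<lambda>r. ereal (ln (ln (max_modulus F r)) / ln r))"

text \<open>The type of \<open>F\<close> relative to the order \<open>\<rho>\<close>; minimal type means that it vanishes.\<close>

definition entire_type :: "real \<Rightarrow> (complex \<Rightarrow> complex) \<Rightarrow> ereal" where
  "entire_type \<rho> F = Limsup at_top (\<lambda>r. ereal (ln (max_modulus F r) / r powr \<rho>))"

text \<open>
  \<open>lam\<close> lists the zeros of \<open>F\<close>, all real and infinitely many of them, each as often as its
  multiplicity.
\<close>

definition real_zero_enum :: "(complex \<Rightarrow> complex) \<Rightarrow> (nat \<Rightarrow> real) \<Rightarrow> bool" where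
  "real_zero_enum F lam \<longleftrightarrow>
     (\<forall>z. F z = 0 \<longleftrightarrow> (\<exists>n. z = complex_of_real (lam n))) \<and>
     (\<forall>z. F z = 0 \<longrightarrow> int (card {n. complex_of_real (lam n) = z}) = zorder F z)"

text \<open>
  Powers of complex numbers are principal: \<open>z powr s = exp (s * Ln z)\<close> for \<open>z \<noteq> 0\<close>.
  The library sets \<open>0 powr s = 0\<close> even for \<open>s = 0\<close>, so \<open>f\<close> is left unconstrained at the
  origin.
\<close>

definition class_B ::
  "real \<Rightarrow> (complex \<Rightarrow> complex) \<Rightarrow> (complex \<Rightarrow> complex) \<Rightarrow> (nat \<Rightarrow> real) \<Rightarrow> bool" where
  "class_B \<nu> f F lam \<longleftrightarrow>
     (\<forall>z. z \<noteq> 0 \<longrightarrow> f z = z powr complex_of_real \<nu> * F z) \<and>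
     F holomorphic_on UNIV \<and> F 0 = 1 \<and>
     (entire_order F < 1 \<or> entire_order F = 1 \<and> entire_type 1 F = 0) \<and>
     real_zero_enum F lam \<and>
     summable (\<lambda>n. 1 / \<bar>lam n\<bar>)"

definition series_coeff :: "real \<Rightarrow> real \<Rightarrow> complex \<Rightarrow> nat \<Rightarrow> complex" where
  "series_coeff \<mu> \<beta> a n =
     (a * complex_of_real (\<beta> + 1)) ^ n / complex_of_real (Gamma (\<mu> + real n)) *
     (\<Prod>j=1..n. complex_of_real
        (pochhammer \<mu> j / (pochhammer (\<mu> + \<beta> + 1) j - pochhammer \<mu> j)))"

definition bessel_series :: "complex \<Rightarrow> complex \<Rightarrow> complex" where
  "bessel_series \<kappa> w =
     (\<Sum>k. (- 1) ^ k * rGamma (\<kappa> + of_nat k + 1) / fact k * (w / 2) ^ (2 * k))"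

text \<open>The principal branch of the Bessel function of the first kind, for \<open>w \<noteq> 0\<close>.\<close>

definition bessel_J :: "complex \<Rightarrow> complex \<Rightarrow> complex" where
  "bessel_J \<kappa> w = (w / 2) powr \<kappa> * bessel_series \<kappa> w"

text \<open>
  The same function on the Riemann surface of the logarithm: \<open>l\<close> is any logarithm of the
  argument \<open>w\<close>. The product \<open>c * z powr (1/2)\<close> has the logarithm \<open>Ln c + Ln z / 2\<close>, which
  makes its powers multiplicative; it may differ from the principal one if \<open>c\<close> is a
  negative real.
\<close>

definition bessel_J_log :: "complex \<Rightarrow> complex \<Rightarrow> complex" where
  "bessel_J_log \<kappa> l = exp (\<kappa> * (l - Ln 2)) * bessel_series \<kappa> (exp l)"

lemma bessel_J_eq_log: "w \<noteq> 0 \<Longrightarrow> bessel_J \<kappa> w = bessel_J_log \<kappa> (Ln w)"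
  using Ln_divide_of_real[of 2 w]
  by (simp add: bessel_J_def bessel_J_log_def powr_def Ln_of_real[of 2, simplified])

end

theory Submission
  imports Defs "HOL-Real_Asymp.Real_Asymp"
begin

text \<open>
  Write \<open>w(t) = t powr (\<mu> - 1) * (1 - t) powr \<beta>\<close>. After the power \<open>z powr \<nu>\<close> is absorbed into the
  weight, the hypothesis says that the dilations \<open>t \<mapsto> F(\<lambda>\<^sub>n t)\<close> are pairwise orthogonal with
  respect to \<open>w\<close> on the unit interval. Since \<open>F\<close> is real on the real line, the square of a dilation
  has a positive integral; hence the \<open>\<lambda>\<^sub>n\<close> are distinct, and all zeros are simple.

  The growth condition and the summability of \<open>1 / \<bar>\<lambda>\<^sub>n\<bar>\<close> force \<open>F\<close> to be the canonical product
  of its zeros (\<open>hadamard_factorization\<close>). Because the zeros are real,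
  \<open>\<bar>F(\<i>yt)\<bar> \<le> \<bar>F(\<i>y)\<bar>\<close> for \<open>0 \<le> t \<le> 1\<close>, and for fixed \<open>t < 1\<close> the quotient tends to \<open>0\<close>.
  This is Hardy's mechanism. Let \<open>E(z) = \<integral> F(zt) W\<^sub>0(t) dt + z * \<integral> F(zt) W\<^sub>1(t) dt\<close> vanish at every
  \<open>\<lambda>\<^sub>n\<close>. Then \<open>E / F\<close> is entire and of minimal exponential type, and it is \<open>o(\<bar>y\<bar>)\<close> on the imaginary
  axis; by Phragmen-Lindelof and Liouville it is constant
  (\<open>dilation_integrals_vanishing_at_zeros\<close>).

  The mechanism is used twice. First, \<open>z - \<lambda>\<^sub>n\<close> times \<open>\<integral> F(zt) F(\<lambda>\<^sub>n t) w(t) dt\<close> vanishes at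
  all zeros, so it is a multiple of \<open>F\<close>. Comparing the Taylor coefficients of degree \<open>0\<close> and \<open>1\<close>
  shows that \<open>\<integral> F(zt) w(t) dt + a z \<integral> F(zt) (1 - t) w(t) dt\<close> vanishes at \<open>z = \<lambda>\<^sub>n\<close>
  (\<open>vanishing_combination\<close>). As \<open>n\<close> was arbitrary, the mechanism applies to this function as well and
  yields the integral equation
  \<open>\<integral> F(zt) w(t) dt + a z \<integral> F(zt) (1 - t) w(t) dt = Beta \<mu> (\<beta> + 1) * F(z)\<close>.
  The moments of \<open>w\<close> are Beta values, so comparing coefficients gives a two-term recurrence for the
  Taylor coefficients of \<open>F\<close>, whose solution is the stated series with \<open>C = Gamma \<mu>\<close>.

  In that series the quotient of consecutive coefficients is asymptotic to a constant times
  \<open>n powr - (\<beta> + 2)\<close>; coefficients comparable to \<open>k ^ n / fact n powr (\<beta> + 2)\<close> give the order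
  \<open>1 / (\<beta> + 2)\<close> (\<open>entire_order_power_series\<close>). For \<open>\<beta> = 0\<close> the coefficients reduce to those of the
  Bessel series.
\<close>

section \<open>Entire functions: Taylor series, maximum modulus, simple zeros\<close>

lemma entire_power_series:
  fixes g :: "complex \<Rightarrow> complex"
  assumes sums: "\<And>z. (\<lambda>k. c k * z ^ k) sums g z"
  shows "g holomorphic_on UNIV" "\<And>k. c k = (deriv ^^ k) g 0 / fact k"
proof -
  have "g holomorphic_on ball 0 r" for r
    by (rule power_series_holomorphic[of _ _ c]) (use sums in simp)
  hence "g field_differentiable at z" for z
    using holomorphic_on_imp_differentiable_at[of g "ball 0 (norm z + 1)" z] by auto
  thus "g holomorphic_on UNIV" by (simp add: holomorphic_on_def)
  have "g has_fps_expansion Abs_fps c"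
    by (intro has_fps_expansionI) (simp add: sums)
  from fps_nth_fps_expansion[OF this] show "c k = (deriv ^^ k) g 0 / fact k" for k by simp
qed

lemma entire_taylor_sums:
  assumes "F holomorphic_on UNIV"
  shows "(\<lambda>k. (deriv ^^ k) F 0 / fact k * z ^ k) sums F z"
    and "summable (\<lambda>k. norm ((deriv ^^ k) F 0 / fact k * z ^ k))"
proof -
  show s: "(\<lambda>k. (deriv ^^ k) F 0 / fact k * z ^ k) sums F z" for z
    using holomorphic_power_series[of F 0 "norm z + 1" z] holomorphic_on_subset[OF assms] by simp
  show "summable (\<lambda>k. norm ((deriv ^^ k) F 0 / fact k * z ^ k))"
    by (rule powser_insidea[OF sums_summable[OF s[of "of_real (norm z + 1)"]]]) simp
qed

lemma norm_le_max_modulus: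
  assumes "F holomorphic_on UNIV" "norm z = r"
  shows "norm (F z) \<le> max_modulus F r"
  unfolding max_modulus_def
proof (rule cSUP_upper)
  have "continuous_on (sphere 0 r) (\<lambda>z. norm (F z))"
    by (intro continuous_on_norm continuous_on_subset[OF holomorphic_on_imp_continuous_on[OF assms(1)]]) auto
  hence "compact ((\<lambda>z. norm (F z)) ` sphere 0 r)" by (intro compact_continuous_image) auto
  thus "bdd_above ((\<lambda>z. norm (F z)) ` sphere 0 r)"
    by (intro bounded_imp_bdd_above compact_imp_bounded)
qed (use assms in auto)

lemma max_modulus_le:
  assumes "\<And>z. norm z = r \<Longrightarrow> norm (F z) \<le> B" "r \<ge> 0"
  shows "max_modulus F r \<le> B"
  unfolding max_modulus_def
proof (rule cSUP_least)
  show "sphere (0::complex) r \<noteq> {}" using assms(2) by simp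
qed (use assms in auto)

text \<open>
  Cauchy's estimate, in the form that turns lower bounds for coefficients into lower bounds for
  the order.
\<close>

lemma taylor_coeff_le_max_modulus:
  assumes F: "F holomorphic_on UNIV" and r: "r > 0"
  shows "norm ((deriv ^^ n) F 0 / fact n) * r ^ n \<le> max_modulus F r"
proof -
  have "norm ((deriv ^^ n) F 0) \<le> fact n * max_modulus F r / r ^ n"
  proof (rule Cauchy_inequality[OF _ _ r])
    show "F holomorphic_on ball 0 r" using F by (rule holomorphic_on_subset) auto
    show "continuous_on (cball 0 r) F"
      using holomorphic_on_imp_continuous_on[OF F] by (rule continuous_on_subset) auto
    show "norm (F x) \<le> max_modulus F r" if "norm (0 - x) = r" for x
      using that by (intro norm_le_max_modulus[OF F]) simp
  qed
  thus ?thesis using r by (simp add: norm_divide field_simps)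
qed

text \<open>
  At a zero \<open>z0\<close> of \<open>F\<close> both functions lose a factor \<open>z - z0\<close>, and what remains of \<open>F\<close> is
  \<open>deriv F z0\<close> at \<open>z0\<close>; so the quotient extends with the value given by l'Hospital's rule.
\<close>

lemma entire_division_at_simple_zeros:
  assumes E: "E holomorphic_on UNIV" and F: "F holomorphic_on UNIV"
    and zeros: "\<And>z. F z = 0 \<Longrightarrow> E z = 0 \<and> deriv F z \<noteq> 0"
  obtains h where "h holomorphic_on UNIV" "\<And>z. E z = F z * h z"
proof
  define h where "h z = (if F z = 0 then deriv E z / deriv F z else E z / F z)" for z
  show "E z = F z * h z" for z using zeros[of z] by (simp add: h_def)
  show "h holomorphic_on UNIV"
  proof -
    have "h analytic_on {z0}" for z0
    proof (cases "F z0 = 0")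
      case False
      have "open {z. F z \<noteq> 0}"
        by (intro open_Collect_neq holomorphic_on_imp_continuous_on[OF F] continuous_intros)
      from eventually_nhds_in_open[OF this] have ev: "eventually (\<lambda>z. F z \<noteq> 0) (nhds z0)"
        using False by simp
      have "(\<lambda>z. E z / F z) analytic_on {z0}"
        using E F False by (intro analytic_on_divide) (auto simp: analytic_on_holomorphic)
      moreover have cong: "eventually (\<lambda>z. E z / F z = h z) (nhds z0)"
        using ev by eventually_elim (simp add: h_def)
      ultimately show ?thesis using analytic_at_cong[OF cong refl] by blast
    next
      case True
      define e where "e z = (if z = z0 then deriv E z0 else E z / (z - z0))" for z
      define p where "p z = (if z = z0 then deriv F z0 else F z / (z - z0))" for z
      have e: "e holomorphic_on UNIV"
        by (rule pole_theorem_open_0[OF E, of z0]) (use zeros True in \<open>auto simp: e_def\<close>)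
      have p: "p holomorphic_on UNIV"
        by (rule pole_theorem_open_0[OF F, of z0]) (use True in \<open>auto simp: p_def\<close>)
      have p0: "p z0 \<noteq> 0" using zeros True by (simp add: p_def)
      have "open {z. p z \<noteq> 0}"
        by (intro open_Collect_neq holomorphic_on_imp_continuous_on[OF p] continuous_intros)
      from eventually_nhds_in_open[OF this] have ev: "eventually (\<lambda>z. p z \<noteq> 0) (nhds z0)"
        using p0 by simp
      have "(\<lambda>z. e z / p z) analytic_on {z0}"
        using e p p0 by (intro analytic_on_divide) (auto simp: analytic_on_holomorphic)
      moreover have cong: "eventually (\<lambda>z. e z / p z = h z) (nhds z0)"
        using ev by eventually_elim (use True in \<open>auto simp: h_def e_def p_def\<close>)
      ultimately show ?thesis using analytic_at_cong[OF cong refl] by blast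
    qed
    hence "h analytic_on UNIV" using analytic_on_analytic_at by blast
    thus ?thesis by (simp add: analytic_on_open)
  qed
qed

lemma simple_zero_deriv_nonzero:
  assumes F: "F holomorphic_on UNIV" and nz: "F w \<noteq> 0" and z: "F z = 0" "zorder F z = 1"
  shows "deriv F z \<noteq> 0"
proof -
  define g where "g = zor_poly F z"
  from zorder_exist_zero[OF F open_UNIV connected_UNIV UNIV_I, of z] nz z obtain r where r: "r > 0"
    "g holomorphic_on cball z r" "\<And>w. w \<in> cball z r \<Longrightarrow> F w = g w * (w - z) \<and> g w \<noteq> 0"
    unfolding g_def by force
  have g': "(g has_field_derivative deriv g z) (at z)"
    using r(1) by (intro holomorphic_derivI[of g "ball z r"] holomorphic_on_subset[OF r(2)]) auto
  have "((\<lambda>w. g w * (w - z)) has_field_derivative g z) (at z)"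
    by (rule derivative_eq_intros g' refl | simp)+
  moreover have "eventually (\<lambda>w. g w * (w - z) = F w) (nhds z)"
    using eventually_nhds_in_open[of "ball z r" z] r by (auto elim!: eventually_mono)
  ultimately have "(F has_field_derivative g z) (at z)"
    using DERIV_cong_ev[OF refl, of "\<lambda>w. g w * (w - z)" F z "g z" "g z"] by blast
  hence "deriv F z = g z" by (rule DERIV_imp_deriv)
  thus ?thesis using r(1) r(3)[of z] by simp
qed

section \<open>Functions of minimal exponential type\<close>

text \<open>
  This is the common form of the two growth conditions "order less than one" and "order one and
  minimal type"; unlike them it is visibly stable under sums, products and affine substitutions.
\<close>

definition minimal_exp_type :: "(complex \<Rightarrow> complex) \<Rightarrow> bool" where
  "minimal_exp_type f \<longleftrightarrow> (\<forall>\<epsilon>>0. \<exists>C>0. \<forall>z. norm (f z) \<le> C * exp (\<epsilon> * norm z))"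

lemma minimal_exp_typeE:
  assumes "minimal_exp_type f" "\<epsilon> > 0"
  obtains C where "C > 0" "\<And>z. norm (f z) \<le> C * exp (\<epsilon> * norm z)"
  using assms unfolding minimal_exp_type_def by blast

lemma minimal_exp_type_add:
  assumes "minimal_exp_type f" "minimal_exp_type g"
  shows "minimal_exp_type (\<lambda>z. f z + g z)"
  unfolding minimal_exp_type_def
proof (intro allI impI)
  fix \<epsilon> :: real assume "\<epsilon> > 0"
  from minimal_exp_typeE[OF assms(1) this] obtain C where C: "C > 0" "\<And>z. norm (f z) \<le> C * exp (\<epsilon> * norm z)" by blast
  from minimal_exp_typeE[OF assms(2) \<open>\<epsilon> > 0\<close>] obtain D where D: "D > 0" "\<And>z. norm (g z) \<le> D * exp (\<epsilon> * norm z)" by blast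
  have "norm (f z + g z) \<le> (C + D) * exp (\<epsilon> * norm z)" for z
    using norm_triangle_ineq[of "f z" "g z"] C(2)[of z] D(2)[of z] by (simp add: distrib_right)
  thus "\<exists>C>0. \<forall>z. norm (f z + g z) \<le> C * exp (\<epsilon> * norm z)"
    using C(1) D(1) by (intro exI[of _ "C + D"]) auto
qed

lemma minimal_exp_type_mult:
  assumes "minimal_exp_type f" "minimal_exp_type g"
  shows "minimal_exp_type (\<lambda>z. f z * g z)"
  unfolding minimal_exp_type_def
proof (intro allI impI)
  fix \<epsilon> :: real assume "\<epsilon> > 0"
  hence e2: "\<epsilon> / 2 > 0" by simp
  from minimal_exp_typeE[OF assms(1) e2] obtain C where C: "C > 0" "\<And>z. norm (f z) \<le> C * exp (\<epsilon> / 2 * norm z)" by blast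
  from minimal_exp_typeE[OF assms(2) e2] obtain D where D: "D > 0" "\<And>z. norm (g z) \<le> D * exp (\<epsilon> / 2 * norm z)" by blast
  have "norm (f z * g z) \<le> (C * D) * exp (\<epsilon> * norm z)" for z
  proof -
    have "norm (f z * g z) \<le> (C * exp (\<epsilon> / 2 * norm z)) * (D * exp (\<epsilon> / 2 * norm z))"
      unfolding norm_mult using C D by (intro mult_mono) auto
    also have "\<dots> = (C * D) * (exp (\<epsilon> / 2 * norm z) * exp (\<epsilon> / 2 * norm z))" by simp
    also have "exp (\<epsilon> / 2 * norm z) * exp (\<epsilon> / 2 * norm z) = exp (\<epsilon> * norm z)"
      by (simp flip: exp_add)
    finally show ?thesis .
  qed
  thus "\<exists>C>0. \<forall>z. norm (f z * g z) \<le> C * exp (\<epsilon> * norm z)"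
    using C(1) D(1) by (intro exI[of _ "C * D"]) auto
qed

lemma minimal_exp_type_linear: "minimal_exp_type (\<lambda>z. b + c * z)"
  unfolding minimal_exp_type_def
proof (intro allI impI)
  fix \<epsilon> :: real assume e: "\<epsilon> > 0"
  let ?C = "norm b + norm c / \<epsilon> + 1"
  have "norm (b + c * z) \<le> ?C * exp (\<epsilon> * norm z)" for z
  proof -
    have "norm z \<le> exp (\<epsilon> * norm z) / \<epsilon>"
    proof -
      have "\<epsilon> * norm z \<le> exp (\<epsilon> * norm z)"
        using exp_ge_add_one_self[of "\<epsilon> * norm z"] by linarith
      thus ?thesis using e by (simp add: field_simps)
    qed
    hence "norm c * norm z \<le> norm c * (exp (\<epsilon> * norm z) / \<epsilon>)" by (intro mult_left_mono) auto
    moreover have "norm b * 1 \<le> norm b * exp (\<epsilon> * norm z)" using e by (intro mult_left_mono) auto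
    moreover have "exp (\<epsilon> * norm z) > 0" by simp
    moreover have "norm (b + c * z) \<le> norm b + norm c * norm z" by (metis norm_mult norm_triangle_ineq)
    moreover have "?C * exp (\<epsilon> * norm z) = norm b * exp (\<epsilon> * norm z) + norm c * (exp (\<epsilon> * norm z) / \<epsilon>) + exp (\<epsilon> * norm z)"
      by (simp add: algebra_simps)
    ultimately show ?thesis by linarith
  qed
  thus "\<exists>C>0. \<forall>z. norm (b + c * z) \<le> C * exp (\<epsilon> * norm z)"
    using e by (intro exI[of _ ?C]) (auto simp: add_nonneg_pos)
qed

lemma minimal_exp_type_const: "minimal_exp_type (\<lambda>z. b)"
  using minimal_exp_type_linear[of b 0] by simp

lemma minimal_exp_type_compose_affine:
  assumes "minimal_exp_type f"
  shows "minimal_exp_type (\<lambda>z. f (b + c * z))"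
  unfolding minimal_exp_type_def
proof (intro allI impI)
  fix \<epsilon> :: real assume e: "\<epsilon> > 0"
  let ?d = "\<epsilon> / (norm c + 1)"
  have d: "?d > 0" using e by (simp add: add_nonneg_pos)
  from minimal_exp_typeE[OF assms d] obtain C where C: "C > 0" "\<And>z. norm (f z) \<le> C * exp (?d * norm z)" by blast
  have "norm (f (b + c * z)) \<le> (C * exp (?d * norm b)) * exp (\<epsilon> * norm z)" for z
  proof -
    have "norm (b + c * z) \<le> norm b + norm c * norm z" by (metis norm_mult norm_triangle_ineq)
    also have "\<dots> \<le> norm b + (norm c + 1) * norm z" by (simp add: distrib_right)
    finally have "?d * norm (b + c * z) \<le> ?d * (norm b + (norm c + 1) * norm z)"
      using d by (intro mult_left_mono) auto
    also have "\<dots> = ?d * norm b + \<epsilon> * norm z"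
    proof -
      have "norm c + 1 \<noteq> 0" using norm_ge_zero[of c] by linarith
      thus ?thesis by (simp add: field_simps)
    qed
    finally have "exp (?d * norm (b + c * z)) \<le> exp (?d * norm b) * exp (\<epsilon> * norm z)" by (simp flip: exp_add)
    hence "C * exp (?d * norm (b + c * z)) \<le> C * (exp (?d * norm b) * exp (\<epsilon> * norm z))"
      using C(1) by (intro mult_left_mono) auto
    with C(2)[of "b + c * z"] show ?thesis by (simp add: mult.assoc)
  qed
  thus "\<exists>C>0. \<forall>z. norm (f (b + c * z)) \<le> C * exp (\<epsilon> * norm z)"
    using C(1) by (intro exI[of _ "C * exp (?d * norm b)"]) auto
qed

text \<open>
  Away from the unit disc division by \<open>z\<close> does not increase the modulus; on the disc continuity
  gives a bound.
\<close>

lemma minimal_exp_type_divide_id: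
  assumes "continuous_on UNIV g" "minimal_exp_type (\<lambda>z. z * g z)"
  shows "minimal_exp_type g"
  unfolding minimal_exp_type_def
proof (intro allI impI)
  fix \<epsilon> :: real assume e: "\<epsilon> > 0"
  from minimal_exp_typeE[OF assms(2) e] obtain C where C: "C > 0" "\<And>z. norm (z * g z) \<le> C * exp (\<epsilon> * norm z)" by blast
  have "compact (g ` cball 0 1)"
    by (intro compact_continuous_image continuous_on_subset[OF assms(1)]) auto
  then obtain B where B: "B > 0" "\<And>z. norm z \<le> 1 \<Longrightarrow> norm (g z) \<le> B"
    using bounded_pos[of "g ` cball 0 1"] compact_imp_bounded by auto
  have "norm (g z) \<le> (B + C) * exp (\<epsilon> * norm z)" for z
  proof (cases "norm z \<le> 1")
    case True
    have "B * 1 \<le> (B + C) * exp (\<epsilon> * norm z)" using B C e by (intro mult_mono) auto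
    thus ?thesis using B(2)[OF True] by simp
  next
    case False
    hence "1 * norm (g z) \<le> norm z * norm (g z)" by (intro mult_right_mono) auto
    also have "\<dots> \<le> C * exp (\<epsilon> * norm z)" using C(2)[of z] by (simp add: norm_mult)
    also have "\<dots> \<le> (B + C) * exp (\<epsilon> * norm z)" using B by (intro mult_right_mono) auto
    finally show ?thesis by simp
  qed
  thus "\<exists>C>0. \<forall>z. norm (g z) \<le> C * exp (\<epsilon> * norm z)"
    using B C by (intro exI[of _ "B + C"]) auto
qed

text \<open>
  The hypothesis bounds only \<open>Re G\<close>, by \<open>c + \<epsilon> * R\<close> on the disc of radius \<open>R\<close>. A half plane is mapped
  to the unit disc by a Moebius transformation, so Cauchy's estimate for the derivative (in the spirit of
  Borel and Caratheodory) yields \<open>\<bar>G'\<bar> \<le> 2 * c / R + 2 * \<epsilon>\<close> at the centre.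
\<close>

lemma exp_minimal_exp_type_imp_const:
  assumes hol: "G holomorphic_on UNIV" and mt: "minimal_exp_type (\<lambda>z. exp (G z))"
  shows "G z = G 0"
proof -
  have "deriv G z0 = 0" for z0
  proof -
    define g where "g w = G (z0 + 1 * w) - G z0" for w
    have holg: "g holomorphic_on UNIV" unfolding g_def
      by (intro holomorphic_intros holomorphic_on_compose[of _ UNIV G, unfolded o_def])
           (auto intro!: holomorphic_intros holomorphic_on_subset[OF hol])
    have g0: "g 0 = 0" by (simp add: g_def)
    have dg: "deriv g 0 = deriv G z0"
    proof (rule DERIV_imp_deriv)
      have "(G has_field_derivative deriv G z0) (at (z0 + 1 * 0))"
        using holomorphic_derivI[OF hol open_UNIV, of z0] by simp
      hence "((\<lambda>w. G (z0 + 1 * w)) has_field_derivative deriv G z0 * 1) (at 0)"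
        by (rule DERIV_chain2) (auto intro!: derivative_eq_intros)
      thus "(g has_field_derivative deriv G z0) (at 0)" unfolding g_def
        by (auto intro!: derivative_eq_intros)
    qed
    have "minimal_exp_type (\<lambda>w. exp (G (z0 + 1 * w)) * exp (- G z0))"
      by (intro minimal_exp_type_mult minimal_exp_type_const minimal_exp_type_compose_affine[OF mt])
    hence mtg: "minimal_exp_type (\<lambda>w. exp (g w))" by (simp add: g_def flip: exp_add)
    have step: "norm (deriv g 0) \<le> 2 * \<epsilon>" if e: "\<epsilon> > 0" for \<epsilon> :: real
    proof -
      from minimal_exp_typeE[OF mtg e] obtain C
        where C: "C > 0" "\<And>w. norm (exp (g w)) \<le> C * exp (\<epsilon> * norm w)" by blast
      define c where "c = max 1 (ln C)"
      have Reg: "Re (g w) \<le> c + \<epsilon> * norm w" for w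
      proof -
        have "exp (Re (g w)) \<le> exp (ln C + \<epsilon> * norm w)" using C(2)[of w] C(1) by (simp add: exp_add)
        thus ?thesis by (simp add: c_def)
      qed
      have bound: "norm (deriv g 0) \<le> 2 * c * (1 / real (Suc n)) + 2 * \<epsilon>" for n
      proof -
        define R where "R = real (Suc n)"
        define A where "A = c + \<epsilon> * R"
        have R: "R > 0" by (simp add: R_def)
        have A: "A > 0" using e R by (auto simp: A_def c_def intro: add_pos_nonneg)
        (* \<open>\<zeta> \<mapsto> \<zeta> / (2 * A - \<zeta>)\<close> maps the half plane \<open>Re \<zeta> \<le> A\<close> to the unit disc and fixes \<open>0\<close>. *)
        define \<phi> where "\<phi> w = g w / (of_real (2 * A) - g w)" for w
        have ReA: "Re (g w) \<le> A" if "w \<in> cball 0 R" for w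
        proof -
          have "\<epsilon> * norm w \<le> \<epsilon> * R" using that e by (intro mult_left_mono) auto
          thus ?thesis using Reg[of w] by (simp add: A_def)
        qed
        have nz: "of_real (2 * A) - g w \<noteq> 0" if "w \<in> cball 0 R" for w
        proof
          assume "of_real (2 * A) - g w = 0"
          hence "Re (of_real (2 * A) - g w) = 0" by simp
          thus False using ReA[OF that] A by simp
        qed
        have h: "\<phi> holomorphic_on cball 0 R" unfolding \<phi>_def
          using nz by (intro holomorphic_intros holomorphic_on_subset[OF holg]) auto
        have le1: "norm (\<phi> w) \<le> 1" if "w \<in> cball 0 R" for w
        proof -
          have "norm (g w) \<le> norm (of_real (2 * A) - g w)"
          proof (rule power2_le_imp_le)
            have "(Re (g w))\<^sup>2 \<le> (2 * A - Re (g w))\<^sup>2"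
            proof -
              have "0 \<le> 4 * A * (A - Re (g w))" using A ReA[OF that] by simp
              thus ?thesis by (simp add: power2_eq_square algebra_simps)
            qed
            thus "(norm (g w))\<^sup>2 \<le> (norm (of_real (2 * A) - g w))\<^sup>2"
              by (simp add: cmod_power2)
          qed auto
          thus ?thesis by (simp add: \<phi>_def norm_divide divide_le_eq_1)
        qed
        have "norm ((deriv ^^ 1) \<phi> 0) \<le> fact 1 * 1 / R ^ 1"
        proof (rule Cauchy_inequality[OF _ _ R])
          show "\<phi> holomorphic_on ball 0 R" by (rule holomorphic_on_subset[OF h]) auto
          show "continuous_on (cball 0 R) \<phi>" by (rule holomorphic_on_imp_continuous_on[OF h])
          show "norm (\<phi> x) \<le> 1" if "norm (0 - x) = R" for x using that by (intro le1) auto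
        qed
        moreover have "deriv \<phi> 0 = deriv g 0 / of_real (2 * A)"
        proof (rule DERIV_imp_deriv)
          have "(g has_field_derivative deriv g 0) (at 0)"
            using holomorphic_derivI[OF holg open_UNIV] by simp
          thus "(\<phi> has_field_derivative deriv g 0 / of_real (2 * A)) (at 0)"
            unfolding \<phi>_def using nz[of 0] R A g0
            by (auto intro!: derivative_eq_intros simp: field_simps)
        qed
        ultimately have "norm (deriv g 0) / (2 * A) \<le> 1 / R" using A by (simp add: norm_divide)
        hence "norm (deriv g 0) \<le> 2 * A * (1 / R)" using A R by (simp add: field_simps)
        also have "\<dots> = 2 * c * (1 / R) + 2 * \<epsilon>" using R by (simp add: A_def field_simps)
        finally show ?thesis by (simp add: R_def)
      qed
      have "(\<lambda>n. 2 * c * (1 / real (Suc n)) + 2 * \<epsilon>) \<longlonglongrightarrow> 2 * c * 0 + 2 * \<epsilon>"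
        by (intro tendsto_intros LIMSEQ_Suc[OF lim_1_over_n])
      from tendsto_lowerbound[OF this] bound show ?thesis by simp
    qed
    have "norm (deriv g 0) \<le> 0"
    proof (rule field_le_epsilon)
      fix e :: real assume "e > 0"
      thus "norm (deriv g 0) \<le> 0 + e" using step[of "e / 2"] by simp
    qed
    thus ?thesis using dg by simp
  qed
  hence "(G has_field_derivative 0) (at w)" for w
    using holomorphic_derivI[OF hol open_UNIV, of w] by simp
  hence "G constant_on UNIV"
    by (intro has_field_derivative_0_imp_constant_on) auto
  thus ?thesis by (auto simp: constant_on_def)
qed

lemma minimal_exp_type_of_max_modulus:
  assumes F: "F holomorphic_on UNIV"
    and growth: "\<And>\<epsilon>. \<epsilon> > 0 \<Longrightarrow> eventually (\<lambda>r. max_modulus F r \<le> exp (\<epsilon> * r)) at_top"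
  shows "minimal_exp_type F"
  unfolding minimal_exp_type_def
proof (intro allI impI)
  fix \<epsilon> :: real assume e: "\<epsilon> > 0"
  from growth[OF e] obtain R where R: "\<And>r. r \<ge> R \<Longrightarrow> max_modulus F r \<le> exp (\<epsilon> * r)"
    by (auto simp: eventually_at_top_linorder)
  have "compact (F ` cball 0 R)"
    by (intro compact_continuous_image continuous_on_subset[OF holomorphic_on_imp_continuous_on[OF F]]) auto
  then obtain B where B: "B > 0" "\<And>z. norm z \<le> R \<Longrightarrow> norm (F z) \<le> B"
    using bounded_pos[of "F ` cball 0 R"] compact_imp_bounded by auto
  have "norm (F z) \<le> (B + 1) * exp (\<epsilon> * norm z)" for z
  proof (cases "norm z \<le> R")
    case True
    have "norm (F z) \<le> (B + 1) * 1" using B(2)[OF True] by simp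
    also have "\<dots> \<le> (B + 1) * exp (\<epsilon> * norm z)" using B e by (intro mult_left_mono) auto
    finally show ?thesis .
  next
    case False
    have "norm (F z) \<le> 1 * exp (\<epsilon> * norm z)"
      using norm_le_max_modulus[OF F, of z] R[of "norm z"] False by fastforce
    also have "\<dots> \<le> (B + 1) * exp (\<epsilon> * norm z)" using B by (intro mult_right_mono) auto
    finally show ?thesis .
  qed
  thus "\<exists>C>0. \<forall>z. norm (F z) \<le> C * exp (\<epsilon> * norm z)"
    using B by (intro exI[of _ "B + 1"]) auto
qed

text \<open>
  The normalisation at the origin keeps the maximum modulus at least \<open>1\<close>, so its logarithm is
  nonnegative and the iterated logarithm in the definition of the order can be inverted.
\<close>

lemma order_and_type_imp_minimal_exp_type:
  assumes F: "F holomorphic_on UNIV" and F0: "norm (F 0) \<ge> 1"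
    and growth: "entire_order F < 1 \<or> entire_order F = 1 \<and> entire_type 1 F = 0"
  shows "minimal_exp_type F"
proof (rule minimal_exp_type_of_max_modulus[OF F])
  fix \<epsilon> :: real assume e: "\<epsilon> > 0"
  have M1: "max_modulus F r \<ge> 1" if "r > 0" for r
    using taylor_coeff_le_max_modulus[OF F that, of 0] F0 by simp
  have "eventually (\<lambda>r. ln (max_modulus F r) \<le> \<epsilon> * r) at_top"
    using growth
  proof
    assume "entire_order F < 1"
    then obtain s where s: "entire_order F < ereal s" "ereal s < 1"
      using ereal_dense2 by blast
    have "eventually (\<lambda>r. ereal (ln (ln (max_modulus F r)) / ln r) < ereal s) at_top"
      using s(1) unfolding entire_order_def by (rule Limsup_lessD)
    moreover have "eventually (\<lambda>r. r powr s \<le> \<epsilon> * r) at_top"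
      using s(2) e by (simp add: one_ereal_def) real_asymp
    ultimately show ?thesis using eventually_gt_at_top[of 1]
    proof eventually_elim
      case (elim r)
      show ?case
      proof (cases "ln (max_modulus F r) > 0")
        case True
        have "ln (ln (max_modulus F r)) < s * ln r" using elim by (simp add: field_simps)
        hence "ln (max_modulus F r) < exp (s * ln r)" using True by (metis exp_less_cancel_iff exp_ln)
        thus ?thesis using elim by (simp add: powr_def)
      next
        case False
        moreover have "\<epsilon> * r > 0" using e elim by simp
        ultimately show ?thesis by linarith
      qed
    qed
  next
    assume "entire_order F = 1 \<and> entire_type 1 F = 0"
    hence "entire_type 1 F < ereal \<epsilon>" using e by simp
    hence "eventually (\<lambda>r. ereal (ln (max_modulus F r) / r powr 1) < ereal \<epsilon>) at_top"
      unfolding entire_type_def by (rule Limsup_lessD)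
    thus ?thesis using eventually_gt_at_top[of 0]
      by eventually_elim (simp add: field_simps)
  qed
  thus "eventually (\<lambda>r. max_modulus F r \<le> exp (\<epsilon> * r)) at_top"
    using eventually_gt_at_top[of 0]
  proof eventually_elim
    case (elim r)
    thus ?case using M1[of r] by (metis exp_le_cancel_iff exp_ln less_le_trans zero_less_one)
  qed
qed

section \<open>A Phragmen-Lindelof principle\<close>

text \<open>
  On the half disc \<open>Re z \<ge> 0\<close>, \<open>\<bar>z\<bar> \<le> R\<close> the function
  \<open>2 * z - z\<^sup>2 / R\<close> has nonnegative real part on the diameter and real part at least \<open>R\<close> on the arc, while
  at a fixed \<open>z\<close> it stays bounded as \<open>R\<close> grows. Multiplying \<open>f\<close> by \<open>exp (- 2 * \<epsilon> * (2 * z - z\<^sup>2 / R))\<close>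
  therefore kills growth of type \<open>\<epsilon>\<close> on the arc without spoiling the bound on the diameter, and costs
  only a factor that tends to \<open>1\<close> as \<open>\<epsilon>\<close> tends to \<open>0\<close>. The maximum principle does the rest.
\<close>

lemma phragmen_lindelof_half_plane:
  assumes hol: "f holomorphic_on UNIV" and mt: "minimal_exp_type f"
    and bd: "\<And>y. norm (f (\<i> * of_real y)) \<le> M" and M: "M > 0" and z: "Re z \<ge> 0"
  shows "norm (f z) \<le> M"
proof -
  have step: "norm (f z) \<le> M * exp (4 * \<epsilon> * Re z + 2 * \<epsilon>)" if e: "\<epsilon> > 0" for \<epsilon> :: real
  proof -
    from minimal_exp_typeE[OF mt e] obtain C
      where C: "C > 0" "\<And>w. norm (f w) \<le> C * exp (\<epsilon> * norm w)" by blast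
    (* \<open>R \<ge> (norm z)\<^sup>2\<close> makes \<open>z\<^sup>2 / R\<close> harmless at the given point; the last entry makes the
       bound on the arc at most \<open>M\<close>. *)
    define R where "R = Max {1, norm z, norm z ^ 2, ln (C / M) / \<epsilon>}"
    have R: "R \<ge> 1" "R \<ge> norm z" "R \<ge> norm z ^ 2" "R \<ge> ln (C / M) / \<epsilon>"
      by (auto simp: R_def)
    define S where "S = {w. 0 \<le> Re w} \<inter> cball 0 R"
    define g where "g w = f w * exp (- of_real (2 * \<epsilon>) * (2 * w - w ^ 2 / of_real R))" for w
    have nexp: "norm (exp (- of_real (2 * \<epsilon>) * (2 * w - w ^ 2 / of_real R)))
                 = exp (- (2 * \<epsilon>) * (2 * Re w - ((Re w)\<^sup>2 - (Im w)\<^sup>2) / R))" for w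
      by (simp add: power2_eq_square)
    have "norm (g z) \<le> M"
    proof (rule maximum_modulus_frontier[where f = g and S = S and \<xi> = z])
      have holg: "g holomorphic_on UNIV"
        unfolding g_def using R(1) by (intro holomorphic_intros hol) auto
      show "g holomorphic_on interior S" using holg by (rule holomorphic_on_subset) auto
      show "continuous_on (closure S) g"
        using holomorphic_on_imp_continuous_on[OF holg] by (rule continuous_on_subset) auto
      show "bounded S" unfolding S_def by auto
      show "z \<in> S" using R z by (auto simp: S_def)
      fix w assume w: "w \<in> frontier S"
      have "closed S" unfolding S_def by (intro closed_Int closed_halfspace_Re_ge) auto
      hence wS: "w \<in> S" using w frontier_subset_closed by blast
      have "{w. Re w > 0} \<inter> ball 0 R \<subseteq> interior S"
        by (intro interior_maximal open_Int open_halfspace_Re_gt) (auto simp: S_def)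
      hence "w \<notin> {w. Re w > 0} \<inter> ball 0 R" using w by (auto simp: frontier_def)
      with wS consider "Re w = 0" | "norm w = R" by (force simp: S_def)
      thus "norm (g w) \<le> M"
      proof cases
        case 1
        hence "w = \<i> * of_real (Im w)" by (simp add: complex_eq_iff)
        hence "norm (f w) \<le> M" using bd[of "Im w"] by simp
        moreover have "norm (exp (- of_real (2 * \<epsilon>) * (2 * w - w ^ 2 / of_real R))) \<le> 1"
          unfolding nexp using 1 e R(1) by simp
        ultimately have "norm (g w) \<le> M * 1"
          unfolding g_def norm_mult using M by (intro mult_mono) auto
        thus ?thesis by simp
      next
        case 2
        have x: "Re w \<ge> 0" "Re w \<le> R" using wS complex_Re_le_cmod[of w] 2 by (auto simp: S_def)
        have sq: "(Re w)\<^sup>2 + (Im w)\<^sup>2 = R\<^sup>2" using 2 by (simp add: cmod_power2[symmetric])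
        have "2 * Re w - ((Re w)\<^sup>2 - (Im w)\<^sup>2) / R = 2 * Re w - (2 * (Re w)\<^sup>2 - R\<^sup>2) / R"
          using sq by (simp add: algebra_simps)
        also have "\<dots> = R + 2 * (Re w * (R - Re w)) / R"
          using R(1) by (simp add: field_simps power2_eq_square)
        also have "\<dots> \<ge> R" using x R(1) by simp
        finally have ge: "2 * Re w - ((Re w)\<^sup>2 - (Im w)\<^sup>2) / R \<ge> R" .
        have "norm (g w) \<le> (C * exp (\<epsilon> * R)) * exp (- (2 * \<epsilon>) * R)"
          unfolding g_def norm_mult nexp using C(1) C(2)[of w] 2 ge e by (intro mult_mono) auto
        also have "\<dots> = C * exp (- \<epsilon> * R)" by (simp flip: exp_add)
        also have "\<dots> \<le> M"
        proof -
          have "ln (C / M) \<le> \<epsilon> * R" using R(4) e by (simp add: field_simps)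
          hence "C / M \<le> exp (\<epsilon> * R)" using C(1) M by (metis divide_pos_pos ln_le_cancel_iff exp_gt_zero ln_exp)
          thus ?thesis using M by (simp add: exp_minus field_simps)
        qed
        finally show ?thesis .
      qed
    qed
    moreover have "f z = g z * exp (of_real (2 * \<epsilon>) * (2 * z - z ^ 2 / of_real R))"
      by (simp add: g_def mult.assoc flip: exp_add)
    moreover have "norm (exp (of_real (2 * \<epsilon>) * (2 * z - z ^ 2 / of_real R))) \<le> exp (4 * \<epsilon> * Re z + 2 * \<epsilon>)"
    proof -
      have "- Re (z ^ 2 / of_real R) \<le> norm (z ^ 2 / of_real R)"
        using abs_Re_le_cmod[of "z ^ 2 / of_real R"] by linarith
      also have "\<dots> \<le> 1" using R(1,3) by (simp add: norm_divide norm_power)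
      finally have "Re (2 * z - z ^ 2 / of_real R) \<le> 2 * Re z + 1" by simp
      hence "2 * \<epsilon> * Re (2 * z - z ^ 2 / of_real R) \<le> 2 * \<epsilon> * (2 * Re z + 1)"
        using e by (intro mult_left_mono) auto
      thus ?thesis by (simp add: algebra_simps)
    qed
    ultimately show ?thesis using M by (simp only: norm_mult) (intro mult_mono, auto)
  qed
  have "((\<lambda>\<epsilon>. M * exp (4 * \<epsilon> * Re z + 2 * \<epsilon>)) \<longlongrightarrow> M * exp (4 * 0 * Re z + 2 * 0)) (at_right 0)"
    by (intro tendsto_intros)
  moreover have "eventually (\<lambda>\<epsilon>. norm (f z) \<le> M * exp (4 * \<epsilon> * Re z + 2 * \<epsilon>)) (at_right 0)"
    using step by (auto simp: eventually_at_right_field intro: exI[of _ 1])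
  ultimately have "norm (f z) \<le> M * exp (4 * 0 * Re z + 2 * 0)"
    by (rule tendsto_lowerbound) simp
  thus ?thesis by simp
qed

lemma minimal_exp_type_bounded_imaginary_axis_imp_const:
  assumes hol: "f holomorphic_on UNIV" and mt: "minimal_exp_type f"
    and bd: "\<And>y. norm (f (\<i> * of_real y)) \<le> M"
  shows "f z = f 0"
proof -
  define K where "K = max M 1"
  have K: "K > 0" "\<And>y. norm (f (\<i> * of_real y)) \<le> K" using bd by (auto simp: K_def max.coboundedI1)
  have "norm (f w) \<le> K" for w
  proof (cases "Re w \<ge> 0")
    case True
    thus ?thesis by (rule phragmen_lindelof_half_plane[OF hol mt K(2) K(1)])
  next
    case False
    have "norm (f (0 + (-1) * (-w))) \<le> K"
    proof (rule phragmen_lindelof_half_plane[where f = "\<lambda>z. f (0 + (-1) * z)"])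
      show "(\<lambda>z. f (0 + (-1) * z)) holomorphic_on UNIV"
        by (rule holomorphic_on_compose[of _ UNIV f, unfolded o_def])
           (auto intro!: holomorphic_intros holomorphic_on_subset[OF hol])
      show "norm (f (0 + - 1 * (\<i> * of_real y))) \<le> K" for y using K(2)[of "-y"] by simp
    qed (use False K(1) minimal_exp_type_compose_affine[OF mt, of 0 "-1"] in auto)
    thus ?thesis by simp
  qed
  hence "bounded (range f)" by (auto simp: bounded_iff)
  from Liouville_theorem[OF hol this] show ?thesis by (auto simp: constant_on_def)
qed

text \<open>
  The difference quotient \<open>(f z - f 0) / z\<close> is bounded on the imaginary axis, hence constant; so
  \<open>f\<close> is affine, and the limit along the axis excludes a linear term.
\<close>

lemma minimal_exp_type_sublinear_imaginary_axis_imp_const: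
  assumes hol: "f holomorphic_on UNIV" and mt: "minimal_exp_type f"
    and bd: "\<And>y. norm (f (\<i> * of_real y)) \<le> A + B * \<bar>y\<bar>"
    and lim: "(\<lambda>n. f (\<i> * of_nat n) / of_nat n) \<longlonglongrightarrow> 0"
  shows "f z = f 0"
proof -
  define g where "g w = (if w = 0 then deriv f 0 else (f w - f 0) / w)" for w
  have f_eq: "f w = f 0 + w * g w" for w by (auto simp: g_def)
  have holg: "g holomorphic_on UNIV"
  proof -
    have "(\<lambda>w. f w - f 0) holomorphic_on UNIV" by (intro holomorphic_intros hol)
    moreover have "deriv (\<lambda>w. f w - f 0) 0 = deriv f 0"
      using holomorphic_derivI[OF hol open_UNIV, of 0] by (intro DERIV_imp_deriv) (auto intro!: derivative_eq_intros)
    ultimately show ?thesis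
      by (intro pole_theorem_open_0[of "\<lambda>w. f w - f 0" UNIV 0 g]) (auto simp: g_def)
  qed
  have contg: "continuous_on UNIV g" using holg by (rule holomorphic_on_imp_continuous_on)
  have mtg: "minimal_exp_type g"
  proof (rule minimal_exp_type_divide_id[OF contg])
    have "(\<lambda>z. z * g z) = (\<lambda>z. f z + (- f 0))" by (subst f_eq) auto
    thus "minimal_exp_type (\<lambda>z. z * g z)"
      using minimal_exp_type_add[OF mt minimal_exp_type_const[of "- f 0"]] by simp
  qed
  have "compact (g ` cball 0 1)"
    by (intro compact_continuous_image continuous_on_subset[OF contg]) auto
  then obtain D where D: "D > 0" "\<And>z. norm z \<le> 1 \<Longrightarrow> norm (g z) \<le> D"
    using bounded_pos[of "g ` cball 0 1"] compact_imp_bounded by auto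
  define M where "M = max D (\<bar>A\<bar> + \<bar>B\<bar> + norm (f 0))"
  have gconst: "g w = g 0" for w
  proof (rule minimal_exp_type_bounded_imaginary_axis_imp_const[OF holg mtg])
    fix y :: real
    show "norm (g (\<i> * of_real y)) \<le> M"
    proof (cases "\<bar>y\<bar> \<le> 1")
      case True thus ?thesis using D(2)[of "\<i> * of_real y"] by (simp add: M_def norm_mult)
    next
      case False
      hence y: "\<bar>y\<bar> > 1" by simp
      have "\<bar>y\<bar> * norm (g (\<i> * of_real y)) = norm (\<i> * of_real y * g (\<i> * of_real y))"
        by (simp add: norm_mult)
      also have "\<dots> = norm (f (\<i> * of_real y) - f 0)" using f_eq[of "\<i> * of_real y"] by simp
      also have "\<dots> \<le> A + B * \<bar>y\<bar> + norm (f 0)" using norm_triangle_ineq4[of "f (\<i> * of_real y)" "f 0"] bd[of y] by linarith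
      also have "\<dots> \<le> \<bar>A\<bar> * \<bar>y\<bar> + \<bar>B\<bar> * \<bar>y\<bar> + norm (f 0) * \<bar>y\<bar>"
      proof -
        have "A \<le> \<bar>A\<bar> * \<bar>y\<bar>" using mult_left_mono[of 1 "\<bar>y\<bar>" "\<bar>A\<bar>"] y by auto
        moreover have "B * \<bar>y\<bar> \<le> \<bar>B\<bar> * \<bar>y\<bar>" by (intro mult_right_mono) auto
        moreover have "norm (f 0) \<le> norm (f 0) * \<bar>y\<bar>" using mult_left_mono[of 1 "\<bar>y\<bar>" "norm (f 0)"] y by auto
        ultimately show ?thesis by linarith
      qed
      also have "\<dots> = \<bar>y\<bar> * (\<bar>A\<bar> + \<bar>B\<bar> + norm (f 0))" by (simp add: algebra_simps)
      finally have "norm (g (\<i> * of_real y)) \<le> \<bar>A\<bar> + \<bar>B\<bar> + norm (f 0)" using y by (simp add: mult_le_cancel_left)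
      thus ?thesis by (simp add: M_def)
    qed
  qed
  have "(\<lambda>n. f (\<i> * of_nat n) / of_nat n) \<longlonglongrightarrow> \<i> * g 0"
  proof -
    have "(\<lambda>n. f 0 * (1 / of_nat n) + \<i> * g 0) \<longlonglongrightarrow> f 0 * 0 + \<i> * g 0"
      by (intro tendsto_intros lim_1_over_n)
    moreover have "eventually (\<lambda>n. f 0 * (1 / of_nat n) + \<i> * g 0 = f (\<i> * of_nat n) / of_nat n) sequentially"
      using eventually_gt_at_top[of 0]
    proof eventually_elim
      case (elim n)
      have "f (\<i> * of_nat n) = f 0 + \<i> * of_nat n * g 0" using f_eq[of "\<i> * of_nat n"] gconst by metis
      thus ?case using elim by (simp add: field_simps)
    qed
    ultimately show ?thesis by (simp add: Lim_transform_eventually)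
  qed
  from LIMSEQ_unique[OF lim this] have "g 0 = 0" by simp
  thus ?thesis using f_eq[of z] gconst[of z] by simp
qed

section \<open>Products over real zeros\<close>

text \<open>
  The right-hand side is \<open>\<bar>sin (arg z)\<bar>\<close>, the distance from \<open>1\<close> to the real line through \<open>0\<close> and
  \<open>z\<close>. It bounds each factor of the product from below uniformly in the real zero \<open>l\<close>.
\<close>

lemma norm_one_minus_divide_real_ge:
  fixes z :: complex and l :: real
  assumes "l \<noteq> 0"
  shows "norm (1 - z / of_real l) \<ge> \<bar>Im z\<bar> / norm z"
proof (cases "z = 0")
  case False
  define u where "u = z / of_real l"
  have u: "u \<noteq> 0" using False assms by (simp add: u_def)
  have "Im (cnj u * (1 - u)) = - Im u" by (simp add: algebra_simps)
  hence "\<bar>Im u\<bar> \<le> norm (cnj u * (1 - u))" using abs_Im_le_cmod[of "cnj u * (1 - u)"] by simp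
  also have "\<dots> = norm u * norm (1 - u)" by (simp only: norm_mult complex_mod_cnj)
  finally have "\<bar>Im u\<bar> / norm u \<le> norm (1 - u)" using u by (simp add: field_simps)
  moreover have "\<bar>Im u\<bar> / norm u = \<bar>Im z\<bar> / norm z"
  proof -
    have "norm u = norm z / \<bar>l\<bar>" "\<bar>Im u\<bar> = \<bar>Im z\<bar> / \<bar>l\<bar>"
      by (simp_all add: u_def norm_divide Im_divide_of_real)
    thus ?thesis using assms by simp
  qed
  ultimately show ?thesis unfolding u_def[symmetric] by simp
qed auto

text \<open>
  A single lower bound for both near and far zeros, in a form whose product over \<open>l\<close> is controlled
  by the sum of \<open>1 / \<bar>l\<bar>\<close>: for \<open>\<bar>l\<bar> \<ge> 2 * \<bar>z\<bar>\<close> the exponential factor suffices, otherwise the exponent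
  of \<open>\<bar>sin (arg z)\<bar>\<close> is at least \<open>1\<close>.
\<close>

lemma norm_one_minus_divide_real_ge_powr:
  fixes z :: complex and l :: real
  assumes l: "l \<noteq> 0" and z: "Im z \<noteq> 0"
  shows "norm (1 - z / of_real l) \<ge> (\<bar>Im z\<bar> / norm z * exp (-1)) powr (2 * (norm z / \<bar>l\<bar>))"
proof -
  define s where "s = \<bar>Im z\<bar> / norm z"
  define x where "x = norm z / \<bar>l\<bar>"
  have z0: "z \<noteq> 0" using z by auto
  have s: "0 < s" "s \<le> 1" using z z0 abs_Im_le_cmod[of z] by (auto simp: s_def)
  have x: "x > 0" using z0 l by (simp add: x_def)
  have split: "(s * exp (-1)) powr (2 * x) = s powr (2 * x) * exp (- (2 * x))"
    using s by (simp add: powr_mult) (simp add: powr_def)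
  have "(s * exp (-1)) powr (2 * x) \<le> norm (1 - z / of_real l)"
  proof (cases "x \<le> 1 / 2")
    case True
    have "s powr (2 * x) \<le> 1" using s x by (simp add: powr_le1)
    hence "(s * exp (-1)) powr (2 * x) \<le> 1 * exp (- (2 * x))"
      unfolding split by (intro mult_right_mono) auto
    also have "\<dots> \<le> 1 - x"
    proof -
      have "x * (1 - 2 * x) \<ge> 0" using True x by simp
      hence "1 \<le> (1 - x) * (1 + 2 * x)" by (simp add: algebra_simps)
      also have "\<dots> \<le> (1 - x) * exp (2 * x)" using True by (intro mult_left_mono exp_ge_add_one_self) auto
      finally show ?thesis by (simp add: exp_minus field_simps)
    qed
    also have "\<dots> \<le> norm (1 - z / of_real l)"
      using norm_triangle_ineq2[of 1 "z / of_real l"] by (simp add: x_def norm_divide)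
    finally show ?thesis .
  next
    case False
    have "(s * exp (-1)) powr (2 * x) \<le> s powr (2 * x)"
      unfolding split using x by (intro mult_left_le) auto
    also have "\<dots> \<le> s powr 1"
      using s False by (intro powr_mono') auto
    also have "\<dots> = s" using s by simp
    also have "\<dots> \<le> norm (1 - z / of_real l)"
      unfolding s_def by (rule norm_one_minus_divide_real_ge[OF l])
    finally show ?thesis .
  qed
  thus ?thesis by (simp add: s_def x_def)
qed

lemma prod_lessThan_split:
  fixes f :: "nat \<Rightarrow> 'a :: comm_monoid_mult"
  assumes "N \<le> M"
  shows "(\<Prod>n<M. f n) = (\<Prod>n<N. f n) * (\<Prod>n=N..<M. f n)"
  using assms by (simp add: lessThan_atLeast0 prod.atLeastLessThan_concat)

locale real_zeros_product =
  fixes lam :: "nat \<Rightarrow> real"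
  assumes lam_nonzero: "\<And>n. lam n \<noteq> 0"
    and summable_lam: "summable (\<lambda>n. 1 / \<bar>lam n\<bar>)"
begin

sublocale W: weierstrass_product "\<lambda>n. complex_of_real (lam n)" "\<lambda>_. 0"
proof
  show "complex_of_real (lam n) \<noteq> 0" for n using lam_nonzero by simp
  have "(\<lambda>n. 1 / \<bar>lam n\<bar>) \<longlonglongrightarrow> 0" by (rule summable_LIMSEQ_zero[OF summable_lam])
  hence "filterlim (\<lambda>n. inverse (1 / \<bar>lam n\<bar>)) at_top sequentially"
    by (intro filterlim_inverse_at_top) (auto simp: lam_nonzero)
  thus "filterlim (\<lambda>n. complex_of_real (lam n)) at_infinity sequentially"
    by (intro filterlim_norm_at_top_imp_at_infinity) (simp add: field_simps)
  show "summable (\<lambda>n. (r / norm (complex_of_real (lam n))) ^ Suc 0)" for r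
    using summable_mult[OF summable_lam, of r] by simp
qed

abbreviation P :: "complex \<Rightarrow> complex" where "P \<equiv> W.f"

lemma partial_products_tendsto: "(\<lambda>N. \<Prod>n<N. 1 - z / of_real (lam n)) \<longlonglongrightarrow> P z"
  using has_prod_imp_tendsto'[OF W.has_prod[of z]] by (simp add: weierstrass_factor_def)

lemma P_0: "P 0 = 1"
  using LIMSEQ_unique[OF partial_products_tendsto[of 0]] by simp

lemma P_real: "P (of_real x) \<in> \<real>"
proof (rule closed_sequentially[OF closed_complex_Reals _ partial_products_tendsto])
  show "(\<Prod>n<N. 1 - complex_of_real x / of_real (lam n)) \<in> \<real>" for N
    by (intro prod_in_Reals Reals_diff Reals_divide) auto
qed

text \<open>
  The first \<open>N\<close> factors contribute a fixed power of \<open>\<bar>sin (arg z)\<bar>\<close>; the remaining zeros have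
  \<open>\<Sum> 1 / \<bar>\<lambda>\<bar> < \<epsilon>\<close> and contribute, by \<open>norm_one_minus_divide_real_ge_powr\<close>, a power proportional to \<open>\<epsilon> * \<bar>z\<bar>\<close>. The
  total exponent is rounded up to a natural number because it becomes the exponent of a polynomial below.
\<close>

lemma norm_P_lower_bound:
  assumes e: "\<epsilon> > 0"
  obtains N where "\<And>z. Im z \<noteq> 0 \<Longrightarrow>
    norm (P z) \<ge> (\<bar>Im z\<bar> / norm z) ^ (N + nat \<lceil>2 * \<epsilon> * norm z\<rceil>) * exp (- (2 * \<epsilon> * norm z))"
proof -
  obtain N where N': "\<And>m n. m \<ge> N \<Longrightarrow> norm (\<Sum>k=m..n. 1 / \<bar>lam k\<bar>) < \<epsilon>"
    using summable_partial_sum_bound[OF summable_lam e] by blast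
  have N: "(\<Sum>n=N..<M. 1 / \<bar>lam n\<bar>) < \<epsilon>" for M
  proof (cases M)
    case (Suc n)
    have "(\<Sum>k=N..n. 1 / \<bar>lam k\<bar>) < \<epsilon>" using N'[of N n] by (simp add: abs_less_iff)
    thus ?thesis by (simp add: Suc atLeastLessThanSuc_atLeastAtMost)
  qed (use e in auto)
  show ?thesis
  proof (rule that[of N])
    fix z :: complex assume z: "Im z \<noteq> 0"
    define r where "r = norm z"
    define s where "s = \<bar>Im z\<bar> / norm z"
    define q where "q = s * exp (-1)"
    have z0: "z \<noteq> 0" using z by auto
    have r: "r > 0" using z0 by (simp add: r_def)
    have s: "0 < s" "s \<le> 1" using z z0 abs_Im_le_cmod[of z] by (auto simp: s_def)
    have q: "0 < q" "q \<le> 1" using s mult_mono[of s 1 "exp (-1)" 1] by (auto simp: q_def)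
    let ?k = "nat \<lceil>2 * \<epsilon> * r\<rceil>"
    have ev: "s ^ (N + ?k) * exp (- (2 * \<epsilon> * r)) \<le> norm (\<Prod>n<M. 1 - z / of_real (lam n))" if M: "M \<ge> N" for M
    proof -
      have "norm (\<Prod>n<M. 1 - z / of_real (lam n)) =
          (\<Prod>n<N. norm (1 - z / of_real (lam n))) * (\<Prod>n=N..<M. norm (1 - z / of_real (lam n)))"
        by (simp add: prod_lessThan_split[OF M] norm_mult flip: prod_norm)
      also have "\<dots> \<ge> (\<Prod>n<N. s) * (\<Prod>n=N..<M. q powr (2 * (r / \<bar>lam n\<bar>)))"
        unfolding s_def q_def r_def using z
        by (intro mult_mono prod_mono prod_nonneg conjI norm_one_minus_divide_real_ge
              norm_one_minus_divide_real_ge_powr lam_nonzero) auto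
      also have "(\<Prod>n=N..<M. q powr (2 * (r / \<bar>lam n\<bar>))) = q powr (2 * r * (\<Sum>n=N..<M. 1 / \<bar>lam n\<bar>))"
        using q by (subst powr_sum[symmetric]) (auto simp: sum_distrib_left)
      finally have fin: "s ^ N * q powr (2 * r * (\<Sum>n=N..<M. 1 / \<bar>lam n\<bar>)) \<le> norm (\<Prod>n<M. 1 - z / of_real (lam n))"
        by simp
      have qle: "q powr (2 * r * (\<Sum>n=N..<M. 1 / \<bar>lam n\<bar>)) \<ge> q powr (2 * r * \<epsilon>)"
        using q r N[of M] by (intro powr_mono') auto
      have qeq: "q powr (2 * r * \<epsilon>) = s powr (2 * \<epsilon> * r) * exp (- (2 * \<epsilon> * r))"
        using s by (simp add: q_def powr_mult mult_ac) (simp add: powr_def mult_ac)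
      have powk: "s powr (2 * \<epsilon> * r) \<ge> s powr real ?k"
        using s r e by (intro powr_mono') auto
      have powk': "s powr real ?k = s ^ ?k" using s by (simp add: powr_realpow)
      have "s ^ N * (s ^ ?k * exp (- (2 * \<epsilon> * r))) \<le> norm (\<Prod>n<M. 1 - z / of_real (lam n))"
      proof -
        have "s ^ ?k * exp (- (2 * \<epsilon> * r)) \<le> q powr (2 * r * (\<Sum>n=N..<M. 1 / \<bar>lam n\<bar>))"
        proof -
          have "s ^ ?k * exp (- (2 * \<epsilon> * r)) \<le> s powr (2 * \<epsilon> * r) * exp (- (2 * \<epsilon> * r))"
            using powk powk' by (intro mult_right_mono) auto
          thus ?thesis using qle qeq by linarith
        qed
        hence "s ^ N * (s ^ ?k * exp (- (2 * \<epsilon> * r))) \<le> s ^ N * q powr (2 * r * (\<Sum>n=N..<M. 1 / \<bar>lam n\<bar>))"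
          using s by (intro mult_left_mono) auto
        thus ?thesis using fin by linarith
      qed
      thus ?thesis by (simp add: power_add mult_ac)
    qed
    have "s ^ (N + ?k) * exp (- (2 * \<epsilon> * r)) \<le> norm (P z)"
      by (rule tendsto_lowerbound[OF tendsto_norm[OF partial_products_tendsto]
            eventually_sequentiallyI[of N, OF ev] sequentially_bot])
    thus "(\<bar>Im z\<bar> / norm z) ^ (N + nat \<lceil>2 * \<epsilon> * norm z\<rceil>) * exp (- (2 * \<epsilon> * norm z)) \<le> norm (P z)"
      by (simp add: s_def r_def)
  qed
qed

text \<open>
  The lower bound for \<open>P\<close> degenerates at the real axis only like \<open>\<bar>Im w\<bar> ^ m\<close> with \<open>m = o(r)\<close> on the
  circle \<open>\<bar>w\<bar> = r\<close>. There \<open>\<bar>w\<^sup>2 - r\<^sup>2\<bar> = 2 * r * \<bar>Im w\<bar>\<close>, so \<open>(w\<^sup>2 - r\<^sup>2) ^ m\<close> cancels exactly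
  this degeneration, and by the maximum principle \<open>h\<close> is bounded by \<open>exp (o(r))\<close> well inside the circle.
\<close>

lemma quotient_minimal_exp_type:
  assumes holh: "h holomorphic_on UNIV" and mE: "minimal_exp_type E"
    and E: "\<And>z. E z = P z * h z"
  shows "minimal_exp_type h"
  unfolding minimal_exp_type_def
proof (intro allI impI)
  fix \<epsilon> :: real assume "\<epsilon> > 0"
  (* The proof below bounds \<open>h\<close> by a constant times \<open>exp (7 * d * r)\<close> with \<open>r = 2 * norm z + 1\<close>. *)
  define d where "d = \<epsilon> / 14"
  have d: "d > 0" using \<open>\<epsilon> > 0\<close> by (simp add: d_def)
  from minimal_exp_typeE[OF mE d] obtain C where C: "C > 0" "\<And>z. norm (E z) \<le> C * exp (d * norm z)" by blast
  from norm_P_lower_bound[OF d] obtain N where N: "\<And>z. Im z \<noteq> 0 \<Longrightarrow>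
    norm (P z) \<ge> (\<bar>Im z\<bar> / norm z) ^ (N + nat \<lceil>2 * d * norm z\<rceil>) * exp (- (2 * d * norm z))" by blast
  have "norm (h z) \<le> C * exp (2 * (N + 1) + 7 * d) * exp (\<epsilon> * norm z)" for z
  proof -
    define r where "r = 2 * norm z + 1"
    define m where "m = N + nat \<lceil>2 * d * r\<rceil>"
    have r: "r > 0" by (simp add: r_def add_nonneg_pos)
    have m: "m > 0" using d r by (simp add: m_def)
    define \<phi> where "\<phi> w = h w * (w\<^sup>2 - of_real (r\<^sup>2)) ^ m" for w
    have hol\<phi>: "\<phi> holomorphic_on UNIV" unfolding \<phi>_def by (intro holomorphic_intros holh)
    define B where "B = C * exp (3 * d * r) * (2 * r\<^sup>2) ^ m"
    have B: "B \<ge> 0" using C(1) by (simp add: B_def)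
    have "norm (\<phi> z) \<le> B"
    proof (rule maximum_modulus_frontier[where f = \<phi> and S = "cball 0 r" and \<xi> = z])
      show "\<phi> holomorphic_on interior (cball 0 r)" using hol\<phi> by (rule holomorphic_on_subset) auto
      show "continuous_on (closure (cball 0 r)) \<phi>"
        using holomorphic_on_imp_continuous_on[OF hol\<phi>] by (rule continuous_on_subset) auto
      show "z \<in> cball 0 r" by (simp add: r_def)
      fix w :: complex assume "w \<in> frontier (cball 0 r)"
      hence w: "norm w = r" by simp
      have sq: "(Re w)\<^sup>2 + (Im w)\<^sup>2 = r\<^sup>2" using w by (simp add: cmod_power2[symmetric])
      have eq: "w\<^sup>2 - of_real (r\<^sup>2) = w * (2 * \<i> * of_real (Im w))"
        using sq by (simp add: complex_eq_iff power2_eq_square algebra_simps)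
      show "norm (\<phi> w) \<le> B"
      proof (cases "Im w = 0")
        case True
        hence "\<phi> w = 0" using m by (simp only: \<phi>_def eq) simp
        thus ?thesis using B by simp
      next
        case False
        define s where "s = \<bar>Im w\<bar> / r"
        have s: "s > 0" using False r by (simp add: s_def)
        have low: "s ^ m * exp (- (2 * d * r)) \<le> norm (P w)"
          using N[OF False] by (simp add: w s_def m_def)
        have "norm (w\<^sup>2 - of_real (r\<^sup>2)) = 2 * r\<^sup>2 * s"
          unfolding eq using r by (simp add: norm_mult w s_def power2_eq_square)
        hence "norm (\<phi> w) = norm (h w) * ((2 * r\<^sup>2) ^ m * s ^ m)"
          by (simp add: \<phi>_def norm_mult norm_power power_mult_distrib)
        also have "\<dots> = (norm (h w) * (s ^ m * exp (- (2 * d * r)))) * (exp (2 * d * r) * (2 * r\<^sup>2) ^ m)"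
          by (simp add: exp_minus field_simps)
        also have "\<dots> \<le> (norm (h w) * norm (P w)) * (exp (2 * d * r) * (2 * r\<^sup>2) ^ m)"
          using low by (intro mult_right_mono mult_left_mono) auto
        also have "norm (h w) * norm (P w) = norm (E w)" by (simp add: E norm_mult)
        also have "norm (E w) * (exp (2 * d * r) * (2 * r\<^sup>2) ^ m) \<le> (C * exp (d * r)) * (exp (2 * d * r) * (2 * r\<^sup>2) ^ m)"
          using C(2)[of w] w by (intro mult_right_mono) auto
        also have "\<dots> = B" by (simp add: B_def algebra_simps flip: exp_add)
        finally show ?thesis .
      qed
    qed auto
    moreover have "norm (h z) * (3 / 4 * r\<^sup>2) ^ m \<le> norm (\<phi> z)"
    proof -
      have "(norm z)\<^sup>2 \<le> (r / 2)\<^sup>2" by (intro power_mono) (auto simp: r_def)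
      hence "3 / 4 * r\<^sup>2 \<le> r\<^sup>2 - norm (z\<^sup>2)" by (simp add: power_divide norm_power)
      also have "\<dots> = norm (complex_of_real (r\<^sup>2)) - norm (z\<^sup>2)"
        by (simp only: norm_of_real abs_of_nonneg zero_le_power2)
      also have "\<dots> \<le> norm (z\<^sup>2 - of_real (r\<^sup>2))"
        by (metis norm_minus_commute norm_triangle_ineq2)
      finally show ?thesis unfolding \<phi>_def norm_mult norm_power
        by (intro mult_left_mono power_mono) auto
    qed
    ultimately have "norm (h z) * (3 / 4 * r\<^sup>2) ^ m \<le> (C * exp (3 * d * r) * (8 / 3) ^ m) * (3 / 4 * r\<^sup>2) ^ m"
    proof -
      have "(2 * r\<^sup>2) ^ m = (8 / 3) ^ m * (3 / 4 * r\<^sup>2) ^ m"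
        by (subst power_mult_distrib[symmetric]) simp
      thus ?thesis using \<open>norm (\<phi> z) \<le> B\<close> \<open>norm (h z) * (3 / 4 * r\<^sup>2) ^ m \<le> norm (\<phi> z)\<close>
        by (simp add: B_def mult.assoc)
    qed
    hence "norm (h z) \<le> C * exp (3 * d * r) * (8 / 3) ^ m"
      by (rule mult_right_le_imp_le) (use r in auto)
    also have "(8 / 3 :: real) ^ m \<le> exp 2 ^ m"
    proof (rule power_mono)
      have "(2::real) \<le> exp 1" using exp_ge_add_one_self[of 1] by simp
      from mult_mono[OF this this] have "4 \<le> exp (2::real)" by (simp flip: exp_add)
      thus "8 / 3 \<le> exp (2::real)" by simp
    qed simp
    also have "exp 2 ^ m = exp (2 * real m)" by (simp add: exp_of_nat_mult mult.commute)
    also have "\<dots> \<le> exp (2 * (N + 1 + 2 * d * r))"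
    proof -
      have "real (nat \<lceil>2 * d * r\<rceil>) \<le> 2 * d * r + 1"
        using d r of_int_ceiling_le_add_one[of "2 * d * r"] by simp
      thus ?thesis by (simp add: m_def)
    qed
    finally have "norm (h z) \<le> C * (exp (3 * d * r) * exp (2 * (N + 1 + 2 * d * r)))"
      using C(1) by (simp add: mult.assoc)
    also have "exp (3 * d * r) * exp (2 * (N + 1 + 2 * d * r)) = exp (2 * (N + 1) + 7 * d) * exp (\<epsilon> * norm z)"
    proof -
      have "3 * d * r + 2 * (N + 1 + 2 * d * r) = (2 * (N + 1) + 7 * d) + \<epsilon> * norm z"
        by (simp add: r_def d_def field_simps)
      thus ?thesis by (metis exp_add)
    qed
    finally show ?thesis by simp
  qed
  thus "\<exists>C>0. \<forall>z. norm (h z) \<le> C * exp (\<epsilon> * norm z)"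
    using C(1) by (intro exI[of _ "C * exp (2 * (N + 1) + 7 * d)"]) auto
qed

text \<open>
  The quotient of \<open>F\<close> and the product is an entire function without zeros, so it is \<open>exp g\<close>; it has
  minimal exponential type by the preceding lemma, hence it is constant.
\<close>

lemma hadamard_factorization:
  assumes holF: "F holomorphic_on UNIV" and F0: "F 0 = 1" and mF: "minimal_exp_type F"
    and enum: "real_zero_enum F lam"
  shows "F = P"
proof -
  have zeros: "F z = 0 \<longleftrightarrow> P z = 0" for z
    using enum W.zero[of z] by (auto simp: real_zero_enum_def)
  have ord: "zorder P z = zorder F z" for z
  proof (cases "F z = 0")
    case True
    have "(\<lambda>n. complex_of_real (lam n)) -` {z} = {n. complex_of_real (lam n) = z}" by auto
    thus ?thesis using W.zorder[of z] enum True by (auto simp: real_zero_enum_def)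
  next
    case False
    have "F analytic_on {z}" using holF by (simp add: analytic_on_holomorphic) blast
    with False zeros show ?thesis by (simp add: zorder_eq_0I W.analytic)
  qed
  obtain h where h: "h holomorphic_on UNIV" "\<And>z. h z \<noteq> 0" "\<And>z. F z = h z * P z"
    using holomorphic_zorder_factorization[of F UNIV P] holF W.holomorphic zeros ord by auto
  have "minimal_exp_type h"
    by (rule quotient_minimal_exp_type[OF h(1) mF]) (simp add: h(3))
  obtain g where g: "g holomorphic_on UNIV" "\<And>z. h z = exp (g z)"
    using simply_connected_eq_holomorphic_log[of UNIV] h(1,2) by (auto simp: convex_imp_simply_connected)
  have "g z = g 0" for z
    using \<open>minimal_exp_type h\<close> g exp_minimal_exp_type_imp_const[OF g(1)] by (metis (no_types, lifting) ext)
  hence "h z = h 0" for z using g(2) by metis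
  moreover have "h 0 = 1" using h(3)[of 0] F0 P_0 by simp
  ultimately show ?thesis using h(3) by auto
qed

text \<open>
  For a real zero \<open>\<lambda>\<close> the factor at \<open>\<i> * y\<close> has modulus \<open>sqrt (1 + (y / \<lambda>)\<^sup>2)\<close>, which increases with
  \<open>\<bar>y\<bar>\<close>. Keeping the first \<open>N\<close> ratios explicit makes one inequality serve both the domination
  (\<open>N = 0\<close>) and the convergence to \<open>0\<close>.
\<close>

lemma norm_P_imaginary_le:
  assumes t: "0 \<le> t" "t \<le> 1"
  shows "norm (P (\<i> * of_real (y * t))) \<le>
    (\<Prod>n<N. norm (1 - \<i> * of_real (y * t) / of_real (lam n)) / norm (1 - \<i> * of_real y / of_real (lam n))) *
    norm (P (\<i> * of_real y))"
proof -
  define a where "a u n = norm (1 - \<i> * of_real (y * u) / complex_of_real (lam n))" for u n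
  have a_eq: "a u n = sqrt (1 + (y * u / lam n)\<^sup>2)" for u n
    by (simp add: a_def cmod_def Re_divide_of_real Im_divide_of_real)
  have a1: "a 1 n > 0" for n unfolding a_eq by (simp add: add_pos_nonneg)
  have a_mono: "a t n \<le> a 1 n" for n
  proof -
    have "(y * t / lam n)\<^sup>2 = (y * 1 / lam n)\<^sup>2 * t\<^sup>2" by (simp add: power_mult_distrib power_divide)
    also have "\<dots> \<le> (y * 1 / lam n)\<^sup>2 * 1" using t by (intro mult_left_mono) (auto simp: power_le_one)
    finally show ?thesis unfolding a_eq by simp
  qed
  have "norm (\<Prod>n<M. 1 - \<i> * of_real (y * t) / complex_of_real (lam n)) \<le>
     (\<Prod>n<N. a t n / a 1 n) * norm (\<Prod>n<M. 1 - \<i> * of_real y / complex_of_real (lam n))" if "M \<ge> N" for M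
  proof -
    have "norm (\<Prod>n<M. 1 - \<i> * of_real (y * t) / complex_of_real (lam n)) = (\<Prod>n<N. a t n) * (\<Prod>n=N..<M. a t n)"
      by (simp add: prod_lessThan_split[OF that] a_def norm_mult flip: prod_norm)
    also have "\<dots> \<le> (\<Prod>n<N. a t n) * (\<Prod>n=N..<M. a 1 n)"
      by (intro mult_left_mono prod_mono prod_nonneg conjI a_mono) (auto simp: a_def)
    also have "(\<Prod>n<N. a t n) = (\<Prod>n<N. a t n / a 1 n) * (\<Prod>n<N. a 1 n)"
      using a1 by (simp add: prod_dividef less_imp_neq[symmetric] prod_zero_iff)
    also have "(\<Prod>n<N. a t n / a 1 n) * (\<Prod>n<N. a 1 n) * (\<Prod>n=N..<M. a 1 n)
        = (\<Prod>n<N. a t n / a 1 n) * norm (\<Prod>n<M. 1 - \<i> * of_real y / complex_of_real (lam n))"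
      by (simp add: prod_lessThan_split[OF that] a_def norm_mult flip: prod_norm)
    finally show ?thesis .
  qed
  hence "eventually (\<lambda>M. norm (\<Prod>n<M. 1 - \<i> * of_real (y * t) / complex_of_real (lam n)) \<le>
     (\<Prod>n<N. a t n / a 1 n) * norm (\<Prod>n<M. 1 - \<i> * of_real y / complex_of_real (lam n))) sequentially"
    by (rule eventually_sequentiallyI)
  hence "norm (P (\<i> * of_real (y * t))) \<le> (\<Prod>n<N. a t n / a 1 n) * norm (P (\<i> * of_real y))"
    by (rule tendsto_le[OF sequentially_bot tendsto_mult_left[OF tendsto_norm[OF partial_products_tendsto]]
          tendsto_norm[OF partial_products_tendsto]])
  thus ?thesis by (simp add: a_def)
qed

lemma P_imaginary_nonzero: "P (\<i> * of_real y) \<noteq> 0"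
proof
  assume "P (\<i> * of_real y) = 0"
  then obtain n where "\<i> * of_real y = complex_of_real (lam n)" using W.zero by auto
  hence "lam n = 0" by (auto simp: complex_eq_iff)
  thus False using lam_nonzero by simp
qed

lemma norm_P_imaginary_ratio_le_1:
  assumes "0 \<le> t" "t \<le> 1"
  shows "norm (P (\<i> * of_real (y * t)) / P (\<i> * of_real y)) \<le> 1"
  using norm_P_imaginary_le[OF assms, of y 0] P_imaginary_nonzero[of y]
  by (simp add: norm_divide divide_le_eq_1)

text \<open>
  Each of the first \<open>N\<close> ratios tends to \<open>t\<close>, so the limit superior is at most \<open>t ^ N\<close> for every
  \<open>N\<close>; this is where the zeros must be infinite in number.
\<close>

lemma P_imaginary_ratio_tendsto_0:
  assumes t: "0 \<le> t" "t < 1"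
  shows "(\<lambda>n. P (\<i> * of_real (real n * t)) / P (\<i> * of_real (real n))) \<longlonglongrightarrow> 0"
proof (rule LIMSEQ_I)
  fix e :: real assume "e > 0"
  then obtain N where N: "t ^ N < e" using real_arch_pow_inv[of e t] t by blast
  define b where "b k n = norm (1 - \<i> * of_real (real n * t) / complex_of_real (lam k)) /
       norm (1 - \<i> * of_real (real n) / complex_of_real (lam k))" for k n
  have "(\<lambda>n. b k n) \<longlonglongrightarrow> t" for k
  proof -
    define c where "c = 1 / (lam k)\<^sup>2"
    have c: "c > 0" using lam_nonzero by (simp add: c_def)
    have "(\<lambda>n. sqrt (((1 / real n)\<^sup>2 + c * t\<^sup>2) / ((1 / real n)\<^sup>2 + c))) \<longlonglongrightarrow> sqrt ((0\<^sup>2 + c * t\<^sup>2) / (0\<^sup>2 + c))"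
      using c by (intro tendsto_intros lim_1_over_n) auto
    moreover have "sqrt ((0\<^sup>2 + c * t\<^sup>2) / (0\<^sup>2 + c)) = t" using c t by simp
    moreover have "eventually (\<lambda>n. sqrt (((1 / real n)\<^sup>2 + c * t\<^sup>2) / ((1 / real n)\<^sup>2 + c)) = b k n) sequentially"
      using eventually_gt_at_top[of 0]
    proof eventually_elim
      case (elim n)
      have "((1 / real n)\<^sup>2 + c * t\<^sup>2) / ((1 / real n)\<^sup>2 + c) = (1 + c * (real n * t)\<^sup>2) / (1 + c * (real n)\<^sup>2)"
      proof -
        have "(1 / real n)\<^sup>2 + c * t\<^sup>2 = (1 + c * (real n * t)\<^sup>2) / (real n)\<^sup>2"
          using elim by (simp add: field_simps power_mult_distrib)
        moreover have "(1 / real n)\<^sup>2 + c = (1 + c * (real n)\<^sup>2) / (real n)\<^sup>2"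
          using elim by (simp add: field_simps)
        ultimately show ?thesis using elim by simp
      qed
      thus ?case by (simp add: b_def cmod_def Re_divide_of_real Im_divide_of_real real_sqrt_divide c_def power_divide)
    qed
    ultimately show ?thesis by (simp add: Lim_transform_eventually)
  qed
  hence "(\<lambda>n. \<Prod>k<N. b k n) \<longlonglongrightarrow> (\<Prod>k<N. t)" by (intro tendsto_prod)
  hence "eventually (\<lambda>n. (\<Prod>k<N. b k n) < e) sequentially" using N by (intro order_tendstoD(2)) auto
  moreover have "norm (P (\<i> * of_real (real n * t)) / P (\<i> * of_real (real n)) - 0) \<le> (\<Prod>k<N. b k n)" for n
    using norm_P_imaginary_le[of t "real n" N] t P_imaginary_nonzero[of "real n"]
    by (simp add: b_def norm_divide field_simps)
  ultimately show "\<exists>no. \<forall>n\<ge>no. norm (P (\<i> * of_real (real n * t)) / P (\<i> * of_real (real n)) - 0) < e"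
    unfolding eventually_sequentially by (meson le_less_trans)
qed

lemma deriv_P_real: "deriv P 0 \<in> \<real>"
proof -
  have "(P has_field_derivative deriv P 0) (at 0)"
    using holomorphic_derivI[OF W.holomorphic open_UNIV] by simp
  hence "((\<lambda>h. (P (0 + h) - P 0) / h) \<longlongrightarrow> deriv P 0) (at 0)" by (simp only: DERIV_def)
  moreover have "filterlim (\<lambda>n. complex_of_real (1 / real (Suc n))) (at 0) sequentially"
  proof (rule filterlim_atI)
    have "(\<lambda>n. complex_of_real (1 / real (Suc n))) \<longlonglongrightarrow> of_real 0"
      by (intro tendsto_of_real LIMSEQ_Suc[OF lim_1_over_n])
    thus "(\<lambda>n. complex_of_real (1 / real (Suc n))) \<longlonglongrightarrow> 0" by simp
    show "eventually (\<lambda>n. complex_of_real (1 / real (Suc n)) \<noteq> 0) sequentially"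
      by (intro always_eventually allI) (simp only: of_real_eq_0_iff, simp)
  qed
  ultimately have "(\<lambda>n. (P (0 + complex_of_real (1 / real (Suc n))) - P 0) / complex_of_real (1 / real (Suc n))) \<longlonglongrightarrow> deriv P 0"
    by (rule filterlim_compose)
  thus ?thesis
  proof (rule closed_sequentially[OF closed_complex_Reals, rotated])
    show "(P (0 + complex_of_real (1 / real (Suc n))) - P 0) / complex_of_real (1 / real (Suc n)) \<in> \<real>" for n
      by (intro Reals_divide Reals_diff) (simp_all only: add_0 P_real Reals_of_real P_0 Reals_1)
  qed
qed

end

section \<open>Weighted integrals of dilations\<close>

text \<open>
  The values outside the open interval are set to \<open>0\<close> so that integrals over the unit interval are
  integrals over the line, with no exceptional set at the end points.
\<close>

definition unit_weight :: "(real \<Rightarrow> complex) \<Rightarrow> bool" where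
  "unit_weight W \<longleftrightarrow> integrable lborel W \<and> (\<forall>t. t \<notin> {0<..<1} \<longrightarrow> W t = 0)"

lemma unit_weight_mult:
  assumes W: "unit_weight W" and g: "continuous_on UNIV g"
  shows "unit_weight (\<lambda>t. g t * W t)"
proof -
  have W1: "integrable lborel W" and W0: "\<And>t. t \<notin> {0<..<1} \<Longrightarrow> W t = 0"
    using W by (auto simp: unit_weight_def)
  have "compact (g ` {0..1})" by (intro compact_continuous_image continuous_on_subset[OF g]) auto
  then obtain B where B: "\<And>t. t \<in> {0..1} \<Longrightarrow> norm (g t) \<le> B"
    using compact_imp_bounded by (force simp: bounded_iff)
  have "integrable lborel (\<lambda>t. g t * W t)"
  proof (rule Bochner_Integration.integrable_bound)
    show "integrable lborel (\<lambda>t. of_real B * W t)" using W1 by simp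
    have "g \<in> borel_measurable borel" using g by (rule borel_measurable_continuous_onI)
    thus "(\<lambda>t. g t * W t) \<in> borel_measurable lborel"
      using W1 by (intro borel_measurable_times) auto
    have "norm (g t * W t) \<le> norm (of_real B * W t)" for t
    proof (cases "t \<in> {0<..<1}")
      case True
      hence "norm (g t) \<le> \<bar>B\<bar>" using B[of t] by fastforce
      thus ?thesis by (simp add: norm_mult mult_right_mono)
    qed (simp add: W0)
    thus "AE t in lborel. norm (g t * W t) \<le> norm (of_real B * W t)" by simp
  qed
  thus ?thesis using W0 by (simp add: unit_weight_def)
qed

definition dilation_integral :: "(complex \<Rightarrow> complex) \<Rightarrow> (real \<Rightarrow> complex) \<Rightarrow> complex \<Rightarrow> complex" where
  "dilation_integral F W z = (\<integral>t. F (z * of_real t) * W t \<partial>lborel)"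

lemma dilation_integral_integrable:
  assumes W: "unit_weight W" and F: "F holomorphic_on UNIV"
  shows "integrable lborel (\<lambda>t. F (z * of_real t) * W t)"
proof -
  have "continuous_on UNIV (\<lambda>t. F (z * complex_of_real t))"
    by (intro continuous_on_compose2[OF holomorphic_on_imp_continuous_on[OF F]] continuous_intros) auto
  from unit_weight_mult[OF W this] show ?thesis by (simp add: unit_weight_def)
qed

text \<open>
  Insert the Taylor series of \<open>F\<close> and integrate termwise; dominated by \<open>\<Sum>k. \<bar>c\<^sub>k * z ^ k\<bar> * \<bar>W t\<bar>\<close>. The
  coefficients of \<open>F\<close> are multiplied by the moments of \<open>W\<close>.
\<close>

lemma dilation_integral_sums:
  assumes W: "unit_weight W" and F: "F holomorphic_on UNIV"
  shows "(\<lambda>k. ((deriv ^^ k) F 0 / fact k * (\<integral>t. of_real (t ^ k) * W t \<partial>lborel)) * z ^ k) sums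
           dilation_integral F W z"
proof -
  define c where "c k = (deriv ^^ k) F 0 / fact k" for k
  have W1: "integrable lborel W" and W0: "\<And>t. t \<notin> {0<..<1} \<Longrightarrow> W t = 0"
    using W by (auto simp: unit_weight_def)
  have int: "integrable lborel (\<lambda>t. complex_of_real (t ^ k) * W t)" for k
  proof -
    have "continuous_on UNIV (\<lambda>t. complex_of_real (t ^ k))" by (intro continuous_intros)
    from unit_weight_mult[OF W this] show ?thesis by (simp add: unit_weight_def)
  qed
  have le: "norm (complex_of_real (t ^ k) * W t) \<le> norm (W t)" for t k
  proof (cases "t \<in> {0<..<1}")
    case True
    hence "\<bar>t ^ k\<bar> \<le> 1" by (simp add: power_le_one)
    hence "\<bar>t ^ k\<bar> * norm (W t) \<le> 1 * norm (W t)" by (intro mult_right_mono) auto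
    thus ?thesis by (simp only: norm_mult norm_of_real mult_1_left)
  qed (simp add: W0)
  have s: "summable (\<lambda>k. norm (c k * z ^ k))" unfolding c_def by (rule entire_taylor_sums(2)[OF F])
  have "(\<lambda>k. \<integral>t. c k * z ^ k * (of_real (t ^ k) * W t) \<partial>lborel) sums
        (\<integral>t. (\<Sum>k. c k * z ^ k * (of_real (t ^ k) * W t)) \<partial>lborel)"
  proof (rule sums_integral)
    show "integrable lborel (\<lambda>t. c k * z ^ k * (of_real (t ^ k) * W t))" for k
      using int by (intro integrable_mult_right) auto
    have "summable (\<lambda>k. norm (c k * z ^ k * (of_real (t ^ k) * W t)))" for t
    proof (rule summable_comparison_test'[where N = 0])
      show "summable (\<lambda>k. norm (c k * z ^ k) * norm (W t))" by (rule summable_mult2[OF s])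
      show "norm (norm (c k * z ^ k * (of_real (t ^ k) * W t))) \<le> norm (c k * z ^ k) * norm (W t)" for k
        unfolding real_norm_def abs_norm_cancel norm_mult[of "c k * z ^ k"] abs_mult by (intro mult_left_mono le) auto
    qed
    thus "AE t in lborel. summable (\<lambda>k. norm (c k * z ^ k * (of_real (t ^ k) * W t)))" by simp
    show "summable (\<lambda>k. \<integral>t. norm (c k * z ^ k * (of_real (t ^ k) * W t)) \<partial>lborel)"
    proof (rule summable_comparison_test'[where N = 0])
      show "summable (\<lambda>k. norm (c k * z ^ k) * (\<integral>t. norm (W t) \<partial>lborel))" by (rule summable_mult2[OF s])
      fix k :: nat
      have "(\<integral>t. norm (c k * z ^ k * (of_real (t ^ k) * W t)) \<partial>lborel)
          \<le> (\<integral>t. norm (c k * z ^ k) * norm (W t) \<partial>lborel)"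
      proof (rule integral_mono)
        show "integrable lborel (\<lambda>t. norm (c k * z ^ k * (of_real (t ^ k) * W t)))"
          using int by (intro integrable_norm integrable_mult_right) auto
        show "integrable lborel (\<lambda>t. norm (c k * z ^ k) * norm (W t))"
          using W1 by (intro integrable_mult_right integrable_norm) auto
        show "norm (c k * z ^ k * (of_real (t ^ k) * W t)) \<le> norm (c k * z ^ k) * norm (W t)" for t
          unfolding norm_mult[of "c k * z ^ k"] by (intro mult_left_mono le) auto
      qed
      thus "norm (\<integral>t. norm (c k * z ^ k * (of_real (t ^ k) * W t)) \<partial>lborel)
          \<le> norm (c k * z ^ k) * (\<integral>t. norm (W t) \<partial>lborel)" by simp
    qed
  qed
  moreover have "(\<Sum>k. c k * z ^ k * (of_real (t ^ k) * W t)) = F (z * of_real t) * W t" for t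
  proof -
    have "(\<lambda>k. c k * (z * of_real t) ^ k * W t) sums (F (z * of_real t) * W t)"
      unfolding c_def by (intro sums_mult2 entire_taylor_sums(1)[OF F])
    thus ?thesis by (simp add: sums_iff power_mult_distrib mult_ac)
  qed
  moreover have "(\<integral>t. c k * z ^ k * (of_real (t ^ k) * W t) \<partial>lborel)
      = (c k * (\<integral>t. of_real (t ^ k) * W t \<partial>lborel)) * z ^ k" for k
    by (subst integral_mult_right_zero) (simp add: mult_ac)
  ultimately have "(\<lambda>k. (c k * (\<integral>t. of_real (t ^ k) * W t \<partial>lborel)) * z ^ k) sums
      (\<integral>t. F (z * of_real t) * W t \<partial>lborel)" by (simp only:)
  thus ?thesis unfolding dilation_integral_def c_def .
qed

lemma dilation_integral_holomorphic:
  assumes "unit_weight W" "F holomorphic_on UNIV"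
  shows "dilation_integral F W holomorphic_on UNIV"
  by (rule entire_power_series(1)[OF dilation_integral_sums[OF assms]])

lemma dilation_integral_coeff:
  assumes "unit_weight W" "F holomorphic_on UNIV"
  shows "(deriv ^^ k) (dilation_integral F W) 0 / fact k =
    (deriv ^^ k) F 0 / fact k * (\<integral>t. of_real (t ^ k) * W t \<partial>lborel)"
  by (rule entire_power_series(2)[OF dilation_integral_sums[OF assms], symmetric])

lemma dilation_integral_minimal_exp_type:
  assumes W: "unit_weight W" and F: "F holomorphic_on UNIV" and mF: "minimal_exp_type F"
  shows "minimal_exp_type (dilation_integral F W)"
  unfolding minimal_exp_type_def
proof (intro allI impI)
  fix \<epsilon> :: real assume e: "\<epsilon> > 0"
  from minimal_exp_typeE[OF mF e] obtain C where C: "C > 0" "\<And>z. norm (F z) \<le> C * exp (\<epsilon> * norm z)" by blast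
  have W1: "integrable lborel W" and W0: "\<And>t. t \<notin> {0<..<1} \<Longrightarrow> W t = 0"
    using W by (auto simp: unit_weight_def)
  define K where "K = (\<integral>t. norm (W t) \<partial>lborel)"
  have K: "K \<ge> 0" by (simp add: K_def)
  have "norm (dilation_integral F W z) \<le> (C * (K + 1)) * exp (\<epsilon> * norm z)" for z
  proof -
    have "norm (dilation_integral F W z) \<le> (\<integral>t. norm (F (z * of_real t) * W t) \<partial>lborel)"
      unfolding dilation_integral_def by (rule integral_norm_bound)
    also have "\<dots> \<le> (\<integral>t. (C * exp (\<epsilon> * norm z)) * norm (W t) \<partial>lborel)"
    proof (rule integral_mono)
      show "integrable lborel (\<lambda>t. norm (F (z * of_real t) * W t))"
        by (intro integrable_norm dilation_integral_integrable assms)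
      show "integrable lborel (\<lambda>t. (C * exp (\<epsilon> * norm z)) * norm (W t))"
        using W1 by (intro integrable_mult_right integrable_norm) auto
      fix t :: real
      show "norm (F (z * of_real t) * W t) \<le> (C * exp (\<epsilon> * norm z)) * norm (W t)"
      proof (cases "t \<in> {0<..<1}")
        case True
        have "norm z * \<bar>t\<bar> \<le> norm z * 1" using True by (intro mult_left_mono) auto
        hence "C * exp (\<epsilon> * norm (z * of_real t)) \<le> C * exp (\<epsilon> * norm z)"
          using C(1) e by (simp add: norm_mult)
        with C(2)[of "z * of_real t"] have "norm (F (z * of_real t)) \<le> C * exp (\<epsilon> * norm z)" by linarith
        thus ?thesis by (simp add: norm_mult mult_right_mono)
      qed (simp add: W0)
    qed
    also have "\<dots> = (C * K) * exp (\<epsilon> * norm z)" using W1 by (simp add: K_def)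
    also have "\<dots> \<le> (C * (K + 1)) * exp (\<epsilon> * norm z)" using C(1) K by (intro mult_right_mono) auto
    finally show ?thesis .
  qed
  thus "\<exists>C>0. \<forall>z. norm (dilation_integral F W z) \<le> C * exp (\<epsilon> * norm z)"
    using C(1) K by (intro exI[of _ "C * (K + 1)"]) auto
qed

context real_zeros_product
begin

text \<open>
  Both facts come from the behaviour of \<open>P(\<i>yt) / P(\<i>y)\<close>: it is bounded by \<open>1\<close>, and it tends to
  \<open>0\<close> for each \<open>t < 1\<close>, so dominated convergence applies.
\<close>

lemma dilation_integral_ratio:
  assumes W: "unit_weight W"
  shows dilation_integral_ratio_le:
      "norm (dilation_integral P W (\<i> * of_real y) / P (\<i> * of_real y)) \<le> (\<integral>t. norm (W t) \<partial>lborel)"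
    and dilation_integral_ratio_tendsto:
      "(\<lambda>n. dilation_integral P W (\<i> * of_nat n) / P (\<i> * of_nat n)) \<longlonglongrightarrow> 0"
proof -
  have W1: "integrable lborel W" and W0: "\<And>t. t \<notin> {0<..<1} \<Longrightarrow> W t = 0"
    using W by (auto simp: unit_weight_def)
  define s where "s y t = P (\<i> * of_real (y * t)) / P (\<i> * of_real y) * W t" for y t
  have int: "integrable lborel (\<lambda>t. P (\<i> * of_real y * of_real t) * W t)" for y
    by (rule dilation_integral_integrable[OF W W.holomorphic])
  have s_eq: "s y = (\<lambda>t. P (\<i> * of_real y * of_real t) * W t / P (\<i> * of_real y))" for y
    by (auto simp: s_def mult_ac)
  have s_int: "integrable lborel (s y)" for y
    unfolding s_eq using int[of y] by (intro integrable_divide) auto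
  have ratio: "dilation_integral P W (\<i> * of_real y) / P (\<i> * of_real y) = (\<integral>t. s y t \<partial>lborel)" for y
    unfolding s_eq dilation_integral_def by simp
  have bound: "norm (s y t) \<le> norm (W t)" for y t
  proof (cases "t \<in> {0<..<1}")
    case True
    thus ?thesis unfolding s_def norm_mult[of _ "W t"]
      by (intro mult_left_le_one_le norm_P_imaginary_ratio_le_1) auto
  qed (simp add: W0 s_def)
  have "norm (\<integral>t. s y t \<partial>lborel) \<le> (\<integral>t. norm (s y t) \<partial>lborel)" by (rule integral_norm_bound)
  also have "\<dots> \<le> (\<integral>t. norm (W t) \<partial>lborel)"
    by (intro integral_mono integrable_norm s_int W1 bound)
  finally show "norm (dilation_integral P W (\<i> * of_real y) / P (\<i> * of_real y)) \<le> (\<integral>t. norm (W t) \<partial>lborel)"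
    by (simp add: ratio)
  have "(\<lambda>n. \<integral>t. s (real n) t \<partial>lborel) \<longlonglongrightarrow> (\<integral>t. 0 \<partial>(lborel :: real measure))"
  proof (rule integral_dominated_convergence)
    show "integrable lborel (\<lambda>t. norm (W t))" using W1 by simp
    show "s (real n) \<in> borel_measurable lborel" for n using s_int[of "real n"] by simp
    show "AE t in lborel. norm (s (real n) t) \<le> norm (W t)" for n using bound by simp
    have "(\<lambda>n. s (real n) t) \<longlonglongrightarrow> 0" for t
    proof (cases "t \<in> {0<..<1}")
      case True
      thus ?thesis unfolding s_def by (intro tendsto_mult_left_zero P_imaginary_ratio_tendsto_0) auto
    qed (simp add: W0 s_def)
    thus "AE t in lborel. (\<lambda>n. s (real n) t) \<longlonglongrightarrow> 0" by simp
  qed simp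
  thus "(\<lambda>n. dilation_integral P W (\<i> * of_nat n) / P (\<i> * of_nat n)) \<longlonglongrightarrow> 0"
    using ratio[of "real n" for n] by simp
qed

text \<open>
  Hardy's argument. The quotient of the left-hand side by \<open>P\<close> is entire because the zeros of \<open>P\<close> are
  simple; it has minimal exponential type and is \<open>o(\<bar>y\<bar>)\<close> at \<open>\<i> * y\<close>, so it is constant. Its value is
  found at \<open>z = 0\<close>.
\<close>

theorem dilation_integrals_vanishing_at_zeros:
  assumes W0: "unit_weight W0" and W1: "unit_weight W1"
    and mP: "minimal_exp_type P" and simple: "\<And>n. deriv P (of_real (lam n)) \<noteq> 0"
    and vanish: "\<And>n. dilation_integral P W0 (of_real (lam n)) +
        of_real (lam n) * dilation_integral P W1 (of_real (lam n)) = 0"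
  shows "dilation_integral P W0 z + z * dilation_integral P W1 z = dilation_integral P W0 0 * P z"
proof -
  define E where "E z = dilation_integral P W0 z + z * dilation_integral P W1 z" for z
  have holE: "E holomorphic_on UNIV" unfolding E_def
    by (intro holomorphic_intros dilation_integral_holomorphic W0 W1 W.holomorphic)
  have mE: "minimal_exp_type E" unfolding E_def
    using minimal_exp_type_linear[of 0 1]
    by (intro minimal_exp_type_add minimal_exp_type_mult dilation_integral_minimal_exp_type W0 W1 W.holomorphic mP) simp
  have "E z = 0 \<and> deriv P z \<noteq> 0" if "P z = 0" for z
    using that W.zero simple vanish by (auto simp: E_def)
  from entire_division_at_simple_zeros[OF holE W.holomorphic this] obtain h
    where h: "h holomorphic_on UNIV" "\<And>z. E z = P z * h z" by blast
  have mh: "minimal_exp_type h" by (rule quotient_minimal_exp_type[OF h(1) mE h(2)])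
  have h_eq: "h (\<i> * of_real y) = dilation_integral P W0 (\<i> * of_real y) / P (\<i> * of_real y) +
       \<i> * of_real y * (dilation_integral P W1 (\<i> * of_real y) / P (\<i> * of_real y))" for y
    using h(2)[of "\<i> * of_real y"] P_imaginary_nonzero[of y] by (simp add: E_def field_simps)
  have "h z = h 0"
  proof (rule minimal_exp_type_sublinear_imaginary_axis_imp_const[OF h(1) mh])
    fix y :: real
    have "norm (h (\<i> * of_real y)) \<le> norm (dilation_integral P W0 (\<i> * of_real y) / P (\<i> * of_real y)) +
       norm (\<i> * of_real y * (dilation_integral P W1 (\<i> * of_real y) / P (\<i> * of_real y)))"
      unfolding h_eq by (rule norm_triangle_ineq)
    also have "norm (\<i> * of_real y * (dilation_integral P W1 (\<i> * of_real y) / P (\<i> * of_real y))) =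
      norm (dilation_integral P W1 (\<i> * of_real y) / P (\<i> * of_real y)) * \<bar>y\<bar>"
      by (simp add: norm_mult norm_divide)
    also have "norm (dilation_integral P W0 (\<i> * of_real y) / P (\<i> * of_real y)) + \<dots> \<le>
       (\<integral>t. norm (W0 t) \<partial>lborel) + (\<integral>t. norm (W1 t) \<partial>lborel) * \<bar>y\<bar>"
      by (intro add_mono mult_right_mono dilation_integral_ratio_le W0 W1) auto
    finally show "norm (h (\<i> * of_real y)) \<le> (\<integral>t. norm (W0 t) \<partial>lborel) + (\<integral>t. norm (W1 t) \<partial>lborel) * \<bar>y\<bar>" .
  next
    have "(\<lambda>n. dilation_integral P W0 (\<i> * of_nat n) / P (\<i> * of_nat n) * (1 / of_nat n) +
       \<i> * (dilation_integral P W1 (\<i> * of_nat n) / P (\<i> * of_nat n))) \<longlonglongrightarrow> 0 * 0 + \<i> * 0"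
      by (intro tendsto_intros dilation_integral_ratio_tendsto W0 W1 lim_1_over_n)
    moreover have "eventually (\<lambda>n. dilation_integral P W0 (\<i> * of_nat n) / P (\<i> * of_nat n) * (1 / of_nat n) +
       \<i> * (dilation_integral P W1 (\<i> * of_nat n) / P (\<i> * of_nat n)) = h (\<i> * of_nat n) / of_nat n) sequentially"
      using eventually_gt_at_top[of 0]
    proof eventually_elim
      case (elim n)
      thus ?case using h_eq[of "real n"] by (simp add: add_divide_distrib)
    qed
    ultimately show "(\<lambda>n. h (\<i> * of_nat n) / of_nat n) \<longlonglongrightarrow> 0"
      by (simp add: Lim_transform_eventually)
  qed
  moreover have "h 0 = dilation_integral P W0 0" using h(2)[of 0] by (simp add: E_def P_0)
  ultimately show ?thesis using h(2)[of z] by (simp add: E_def mult.commute)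
qed

end

section \<open>Jacobi weights and their moments\<close>

text \<open>
  The exponents are shifted by \<open>1\<close> so that \<open>p\<close> and \<open>q\<close> are the arguments of the Beta function.
\<close>

definition jacobi_weight :: "real \<Rightarrow> real \<Rightarrow> real \<Rightarrow> real" where
  "jacobi_weight p q t = (if t \<in> {0<..<1} then t powr (p - 1) * (1 - t) powr (q - 1) else 0)"

lemma jacobi_weight_nonneg: "jacobi_weight p q t \<ge> 0"
  by (simp add: jacobi_weight_def)

lemma jacobi_weight_mult_power: "t ^ k * jacobi_weight p q t = jacobi_weight (p + real k) q t"
proof (cases "t \<in> {0<..<1}")
  case True
  hence "t ^ k * t powr (p - 1) = t powr (p + real k - 1)"
    by (simp add: powr_realpow[symmetric] add_diff_eq[symmetric] add.commute[of p] add.assoc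
          flip: powr_add)
  thus ?thesis using True by (simp add: jacobi_weight_def)
qed (auto simp: jacobi_weight_def)

lemma jacobi_weight_mult_one_minus: "(1 - t) * jacobi_weight p q t = jacobi_weight p (q + 1) t"
proof (cases "t \<in> {0<..<1}")
  case True
  hence "(1 - t) * (1 - t) powr (q - 1) = (1 - t) powr (q + 1 - 1)"
    using powr_add[of "1 - t" 1 "q - 1"] by simp
  thus ?thesis using True by (simp add: jacobi_weight_def)
qed (auto simp: jacobi_weight_def)

lemma
  assumes p: "p > 0" and q: "q > 0"
  shows integrable_jacobi_weight: "integrable lborel (jacobi_weight p q)"
    and integral_jacobi_weight: "(\<integral>t. jacobi_weight p q t \<partial>lborel) = Beta p q"
proof -
  have eq: "jacobi_weight p q = (\<lambda>t. if t \<in> {0..1} then t powr (p - 1) * (1 - t) powr (q - 1) else 0)"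
    by (auto simp: jacobi_weight_def fun_eq_iff)
  have "(\<lambda>t. indicator {0..1} t *\<^sub>R (t powr (p - 1) * (1 - t) powr (q - 1))) = jacobi_weight p q"
    by (auto simp: eq fun_eq_iff indicator_def)
  thus int: "integrable lborel (jacobi_weight p q)"
    using integrable_Beta[OF p q] by (simp add: set_integrable_def)
  have "(jacobi_weight p q has_integral Beta p q) UNIV"
    unfolding eq has_integral_restrict_UNIV by (rule has_integral_Beta_real[OF p q])
  thus "(\<integral>t. jacobi_weight p q t \<partial>lborel) = Beta p q"
    using has_integral_integral_lborel[OF int] has_integral_unique by blast
qed

lemma unit_weight_jacobi:
  assumes "p > 0" "q > 0"
  shows "unit_weight (\<lambda>t. complex_of_real (jacobi_weight p q t))"
  using integrable_of_real[OF integrable_jacobi_weight[OF assms]]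
  by (auto simp: unit_weight_def jacobi_weight_def)

lemma moment_jacobi_weight:
  assumes "p > 0" "q > 0"
  shows "(\<integral>t. of_real (t ^ k) * complex_of_real (jacobi_weight p q t) \<partial>lborel) = of_real (Beta (p + real k) q)"
  using integral_jacobi_weight[of "p + real k" q] assms
  by (simp only: of_real_mult[symmetric] jacobi_weight_mult_power integral_complex_of_real)

lemma unit_weight_cmult: "unit_weight W \<Longrightarrow> unit_weight (\<lambda>t. c * W t)"
  using unit_weight_mult[of W "\<lambda>_. c"] by simp

lemma dilation_integral_cmult: "dilation_integral F (\<lambda>t. c * W t) z = c * dilation_integral F W z"
proof -
  have "(\<lambda>t. F (z * of_real t) * (c * W t)) = (\<lambda>t. c * (F (z * of_real t) * W t))"
    by (simp add: mult_ac)
  thus ?thesis by (simp add: dilation_integral_def)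
qed

text \<open>
  For \<open>t > 0\<close> the principal power satisfies \<open>(l * t) powr \<nu> = l powr \<nu> * t powr \<nu>\<close>, even for negative
  \<open>l\<close>. So the powers contribute a nonzero constant and \<open>t powr (2 * \<nu>)\<close>, which together with
  \<open>t powr \<alpha>\<close> is \<open>t powr (\<mu> - 1)\<close>.
\<close>

lemma orthogonality_of_entire_factors:
  fixes l k :: real
  assumes mu: "\<mu> > 0" "\<mu> = 2 * \<nu> + \<alpha> + 1" and beta: "\<beta> > - 1" and F: "F holomorphic_on UNIV"
    and f: "\<And>z. z \<noteq> 0 \<Longrightarrow> f z = z powr complex_of_real \<nu> * F z"
    and l: "l \<noteq> 0" and k: "k \<noteq> 0"
    and orth: "((\<lambda>t. f (complex_of_real (l * t)) * f (complex_of_real (k * t)) *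
        complex_of_real (t powr \<alpha> * (1 - t) powr \<beta>)) has_integral 0) {0..1}"
  shows "(\<integral>t. F (of_real l * of_real t) * F (of_real k * of_real t) *
        of_real (jacobi_weight \<mu> (\<beta> + 1) t) \<partial>lborel) = 0"
proof -
  define g where "g t = F (of_real l * of_real t) * F (of_real k * of_real t) *
        of_real (jacobi_weight \<mu> (\<beta> + 1) t)" for t :: real
  define K where "K = complex_of_real l powr of_real \<nu> * complex_of_real k powr of_real \<nu>"
  have K: "K \<noteq> 0" using l k by (simp add: K_def)
  have "unit_weight (\<lambda>t. F (of_real k * of_real t) * of_real (jacobi_weight \<mu> (\<beta> + 1) t))"
    using mu(1) beta
    by (intro unit_weight_mult unit_weight_jacobi
          continuous_on_compose2[OF holomorphic_on_imp_continuous_on[OF F]] continuous_intros) auto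
  from dilation_integral_integrable[OF this F, of "of_real l"] have int: "integrable lborel g"
    by (simp add: g_def[abs_def] mult.assoc)
  have factor: "f (of_real (x * t)) = of_real (t powr \<nu>) * (of_real x powr of_real \<nu> * F (of_real x * of_real t))"
    if "t > 0" "x \<noteq> 0" for x t :: real
  proof -
    have "(complex_of_real t * of_real x) powr of_real \<nu> = of_real t powr of_real \<nu> * of_real x powr of_real \<nu>"
      using that by (intro powr_times_real_left) auto
    moreover have "complex_of_real t powr of_real \<nu> = of_real (t powr \<nu>)"
      using that by (simp add: powr_of_real)
    ultimately show ?thesis using f[of "of_real (x * t)"] that by (simp add: mult_ac)
  qed
  have eq: "f (of_real (l * t)) * f (of_real (k * t)) * of_real (t powr \<alpha> * (1 - t) powr \<beta>) = K * g t"
    if t: "t \<in> {0<..<1}" for t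
  proof -
    have "t powr (\<mu> - 1) = t powr \<nu> * t powr \<nu> * t powr \<alpha>"
      by (simp add: mu(2) flip: powr_add)
    hence "jacobi_weight \<mu> (\<beta> + 1) t = t powr \<nu> * t powr \<nu> * (t powr \<alpha> * (1 - t) powr \<beta>)"
      using t by (simp add: jacobi_weight_def)
    thus ?thesis using t factor[of t l] factor[of t k] l k
      by (simp only: greaterThanLessThan_iff g_def K_def of_real_mult) (simp add: mult_ac)
  qed
  have "((\<lambda>t. K * g t) has_integral 0) {0<..<1}"
    by (rule has_integral_eq[OF eq orth[unfolded has_integral_Icc_iff_Ioo]])
  hence "((\<lambda>t. if t \<in> {0<..<1} then K * g t else 0) has_integral 0) UNIV"
    by (simp only: has_integral_restrict_UNIV)
  also have "(\<lambda>t. if t \<in> {0<..<1} then K * g t else 0) = (\<lambda>t. K * g t)"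
    by (auto simp: fun_eq_iff g_def jacobi_weight_def)
  finally have "((\<lambda>t. K * g t) has_integral 0) UNIV" .
  moreover have "((\<lambda>t. K * g t) has_integral (\<integral>t. K * g t \<partial>lborel)) UNIV"
    using int by (intro has_integral_integral_lborel) simp
  ultimately have "(\<integral>t. K * g t \<partial>lborel) = 0" by (rule has_integral_unique[symmetric])
  thus ?thesis using K by (simp add: g_def[abs_def])
qed

section \<open>The integral equation and its power series solution\<close>

lemma pochhammer_strict_mono:
  fixes x y :: real
  assumes "0 < x" "x < y"
  shows "pochhammer x (Suc n) < pochhammer y (Suc n)"
proof (induction n)
  case (Suc n)
  have "pochhammer x (Suc n) > 0" using assms by (intro pochhammer_pos) auto
  hence "pochhammer x (Suc n) * (x + real (Suc n)) < pochhammer y (Suc n) * (y + real (Suc n))"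
    using Suc.IH assms by (intro mult_strict_mono) auto
  thus ?case by (simp only: pochhammer_Suc[of x "Suc n"] pochhammer_Suc[of y "Suc n"])
qed (use assms in simp)

lemma
  fixes p q :: real
  assumes p: "p > 0" and q: "q > 0"
  shows Beta_plus_nat: "Beta (p + real k) q = Beta p q * pochhammer p k / pochhammer (p + q) k"
    and Beta_plus_nat_plus_one:
      "Beta (p + real k) (q + 1) = Beta p q * q * pochhammer p (Suc k) / (pochhammer (p + q) (Suc k) * (p + real k))"
proof -
  have ni: "x \<notin> \<int>\<^sub>\<le>\<^sub>0" if "x > 0" for x :: real
    using that nonpos_Ints_nonpos[of x] by auto
  have G: "Gamma x \<noteq> 0" if "x > 0" for x :: real using Gamma_real_pos[OF that] by simp
  have P: "pochhammer x k = Gamma (x + real k) / Gamma x" if "x > 0" for x :: real and k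
    using pochhammer_Gamma[OF ni[OF that]] by simp
  show "Beta (p + real k) q = Beta p q * pochhammer p k / pochhammer (p + q) k"
    using p q G[of p] G[of "p + q"] G[of "p + q + real k"] by (simp add: Beta_def P add_ac)
  have "Gamma (q + 1) = q * Gamma q" by (rule Gamma_plus1[OF ni[OF q]])
  moreover have "pochhammer p (Suc k) = pochhammer p k * (p + real k)" by (rule pochhammer_Suc)
  moreover have "p + real k \<noteq> 0" using p by linarith
  ultimately show "Beta (p + real k) (q + 1) = Beta p q * q * pochhammer p (Suc k) / (pochhammer (p + q) (Suc k) * (p + real k))"
    using p q G[of p] G[of "p + q"] G[of "p + q + real (Suc k)"]
    by (simp add: Beta_def P[of p] P[of "p + q" "Suc k"] add_ac)
qed

lemma series_coeff_0: "series_coeff \<mu> \<beta> a 0 = 1 / of_real (Gamma \<mu>)"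
  by (simp add: series_coeff_def)

lemma series_coeff_Suc:
  assumes "\<mu> > 0"
  shows "series_coeff \<mu> \<beta> a (Suc n) = series_coeff \<mu> \<beta> a n * (a * of_real (\<beta> + 1) *
      of_real (pochhammer \<mu> (Suc n) / (pochhammer (\<mu> + \<beta> + 1) (Suc n) - pochhammer \<mu> (Suc n)) / (\<mu> + real n)))"
proof -
  have "\<mu> + real n \<notin> \<int>\<^sub>\<le>\<^sub>0" using assms nonpos_Ints_nonpos[of "\<mu> + real n"] by auto
  from Gamma_plus1[OF this] have "Gamma (\<mu> + real (Suc n)) = (\<mu> + real n) * Gamma (\<mu> + real n)"
    by (simp add: add_ac)
  thus ?thesis by (simp add: series_coeff_def mult_ac)
qed

text \<open>
  The situation after the factor \<open>z powr \<nu>\<close> has been moved into the weight and \<open>F\<close> has been identified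
  with the canonical product \<open>P\<close>.
\<close>

locale jacobi_orthogonal_dilations = real_zeros_product +
  fixes \<mu> \<beta> :: real
  assumes mu_pos: "\<mu> > 0" and beta_gt: "\<beta> > - 1"
    and mP: "minimal_exp_type P"
    and orthogonal: "\<And>n m. n \<noteq> m \<Longrightarrow>
      (\<integral>t. P (of_real (lam n) * of_real t) * P (of_real (lam m) * of_real t) *
          of_real (jacobi_weight \<mu> (\<beta> + 1) t) \<partial>lborel) = 0"
begin

abbreviation weight :: "real \<Rightarrow> complex" where
  "weight t \<equiv> of_real (jacobi_weight \<mu> (\<beta> + 1) t)"

lemma weight_unit_weight: "unit_weight weight"
  using unit_weight_jacobi[of \<mu> "\<beta> + 1"] mu_pos beta_gt by simp

lemma continuous_dilation: "continuous_on UNIV (\<lambda>t. P (z * complex_of_real t))"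
  by (intro continuous_on_compose2[OF holomorphic_on_imp_continuous_on[OF W.holomorphic]] continuous_intros) auto

lemma unit_weight_dilation: "unit_weight (\<lambda>t. P (z * of_real t) * weight t)"
  by (rule unit_weight_mult[OF weight_unit_weight continuous_dilation])

text \<open>
  On the real line \<open>P\<close> is real, so the integrand is nonnegative; near \<open>t = 0\<close> it is positive because
  \<open>P 0 = 1\<close>.
\<close>

lemma square_integral_nonzero:
  fixes l :: real
  shows "(\<integral>t. P (of_real l * of_real t) * P (of_real l * of_real t) * weight t \<partial>lborel) \<noteq> 0"
proof
  define Q where "Q t = Re (P (of_real (l * t)))" for t
  define h where "h t = (Q t)\<^sup>2 * jacobi_weight \<mu> (\<beta> + 1) t" for t
  have PQ: "P (of_real l * of_real t) = of_real (Q t)" for t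
    using P_real[of "l * t"] by (simp add: Q_def of_real_Re)
  have eq: "P (of_real l * of_real t) * P (of_real l * of_real t) * weight t = of_real (h t)" for t
    by (simp add: PQ h_def power2_eq_square)
  assume "(\<integral>t. P (of_real l * of_real t) * P (of_real l * of_real t) * weight t \<partial>lborel) = 0"
  hence int0: "(\<integral>t. h t \<partial>lborel) = 0" by (simp add: eq)
  have "integrable lborel (\<lambda>t. P (of_real l * of_real t) * (P (of_real l * of_real t) * weight t))"
    by (rule dilation_integral_integrable[OF unit_weight_dilation W.holomorphic])
  hence "integrable lborel (\<lambda>t. complex_of_real (h t))" using eq by (simp add: mult.assoc)
  hence "integrable lborel h" using complex_of_real_integrable_eq by blast
  moreover have "AE t in lborel. 0 \<le> h t" by (simp add: h_def jacobi_weight_nonneg)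
  ultimately have "AE t in lborel. h t = 0" using int0 integral_nonneg_eq_0_iff_AE by blast
  then obtain N where N: "{t. h t \<noteq> 0} \<subseteq> N" "N \<in> null_sets lborel"
    by (auto elim!: AE_E simp: null_sets_def)
  have "continuous_on UNIV Q" unfolding Q_def
    by (intro continuous_on_Re continuous_on_compose2[OF holomorphic_on_imp_continuous_on[OF W.holomorphic]]
          continuous_intros) auto
  hence "open {t. Q t \<noteq> 0}" by (intro open_Collect_neq continuous_intros)
  moreover have "Q 0 = 1" by (simp add: Q_def P_0)
  ultimately have "eventually (\<lambda>t. Q t \<noteq> 0) (nhds 0)"
    using eventually_nhds_in_open[of "{t. Q t \<noteq> 0}" 0] by simp
  then obtain d where d: "d > 0" "\<And>t. \<bar>t\<bar> < d \<Longrightarrow> Q t \<noteq> 0"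
    unfolding eventually_nhds_metric by (auto simp: dist_real_def)
  define e where "e = min d 1"
  have e: "e > 0" using d by (simp add: e_def)
  have "{0<..<e} \<subseteq> N"
  proof
    fix t assume "t \<in> {0<..<e}"
    hence "h t \<noteq> 0" using d(2)[of t] by (simp add: h_def jacobi_weight_def e_def)
    thus "t \<in> N" using N by auto
  qed
  hence "emeasure lborel {0<..<e} \<le> emeasure lborel N"
    using null_setsD2[OF N(2)] by (rule emeasure_mono)
  thus False using e null_setsD1[OF N(2)] by simp
qed

text \<open>
  A repeated zero would make some dilation orthogonal to itself.
\<close>

lemma inj_lam: "inj lam"
proof (rule injI, rule ccontr)
  fix n m assume "lam n = lam m" "n \<noteq> m"
  with orthogonal[of n m] square_integral_nonzero[of "lam n"] show False by simp
qed

lemma deriv_P_lam_nonzero: "deriv P (of_real (lam n)) \<noteq> 0"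
proof (rule simple_zero_deriv_nonzero[of P 0])
  show "P (of_real (lam n)) = 0" using W.zero by auto
  have "(\<lambda>k. complex_of_real (lam k)) -` {of_real (lam n)} = {n}"
    using inj_lam by (auto simp: inj_eq)
  thus "zorder P (of_real (lam n)) = 1" using W.zorder[of "of_real (lam n)"] by simp
qed (auto simp: P_0 W.holomorphic)

text \<open>
  Let \<open>G(z) = \<integral> P(zt) P(lt) w(t) dt\<close>. By orthogonality \<open>(z - l) * G(z)\<close> vanishes at all zeros, hence
  equals \<open>- l * G(0) * P(z)\<close>. Differentiation at \<open>0\<close> gives
  \<open>G(0) - l * G'(0) = - l * a * G(0)\<close> with \<open>a = P'(0)\<close>. Here \<open>G(0)\<close> is the integral of \<open>P(lt)\<close>
  against \<open>w(t)\<close>, and \<open>G'(0)\<close> is \<open>a\<close> times that against \<open>t * w(t)\<close>; so this is the claim, in which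
  only the one dilation \<open>P(lt)\<close> is left.
\<close>

lemma vanishing_combination:
  fixes n :: nat
  defines "l \<equiv> complex_of_real (lam n)"
  shows "dilation_integral P weight l + l * dilation_integral P (\<lambda>t. deriv P 0 * of_real (jacobi_weight \<mu> (\<beta> + 2) t)) l = 0"
proof -
  define W1 where "W1 t = P (l * of_real t) * weight t" for t
  define G where "G = dilation_integral P W1"
  have W1: "unit_weight W1" unfolding W1_def by (rule unit_weight_dilation)
  have "dilation_integral P (\<lambda>t. - l * W1 t) z + z * dilation_integral P W1 z =
      dilation_integral P (\<lambda>t. - l * W1 t) 0 * P z" for z
  proof (rule dilation_integrals_vanishing_at_zeros[OF unit_weight_cmult[OF W1] W1 mP deriv_P_lam_nonzero])
    fix m
    show "dilation_integral P (\<lambda>t. - l * W1 t) (of_real (lam m)) +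
       of_real (lam m) * dilation_integral P W1 (of_real (lam m)) = 0"
    proof (cases "m = n")
      case False
      hence "dilation_integral P W1 (of_real (lam m)) = 0"
        using orthogonal[of m n] by (simp add: dilation_integral_def W1_def l_def mult.assoc)
      thus ?thesis unfolding dilation_integral_cmult by simp
    qed (simp only: dilation_integral_cmult, simp add: l_def)
  qed
  hence eq: "(z - l) * G z = - l * G 0 * P z" for z
    unfolding G_def dilation_integral_cmult by (simp add: algebra_simps)
  have "(G has_field_derivative deriv G 0) (at 0)"
    using holomorphic_derivI[OF dilation_integral_holomorphic[OF W1 W.holomorphic] open_UNIV]
    by (simp add: G_def)
  hence d1: "((\<lambda>z. (z - l) * G z) has_field_derivative (G 0 - l * deriv G 0)) (at 0)"
    by (auto intro!: derivative_eq_intros)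
  have "(P has_field_derivative deriv P 0) (at 0)"
    using holomorphic_derivI[OF W.holomorphic open_UNIV] by simp
  hence d2: "((\<lambda>z. - l * G 0 * P z) has_field_derivative (- l * G 0 * deriv P 0)) (at 0)"
    by (auto intro!: derivative_eq_intros)
  have diff: "G 0 - l * deriv G 0 = - l * G 0 * deriv P 0"
    using DERIV_unique[OF d1] d2 by (simp add: eq)
  have G0: "G 0 = dilation_integral P weight l"
    by (simp add: G_def dilation_integral_def P_0 W1_def)
  have "deriv G 0 = deriv P 0 * (\<integral>t. of_real t * W1 t \<partial>lborel)"
    using dilation_integral_coeff[OF W1 W.holomorphic, of 1] by (simp add: G_def)
  also have "(\<integral>t. of_real t * W1 t \<partial>lborel) =
      dilation_integral P weight l - dilation_integral P (\<lambda>t. of_real (jacobi_weight \<mu> (\<beta> + 2) t)) l"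
  proof -
    have split: "of_real t * W1 t = P (l * of_real t) * weight t -
        P (l * of_real t) * of_real (jacobi_weight \<mu> (\<beta> + 2) t)" for t
    proof -
      have "jacobi_weight \<mu> (\<beta> + 2) t = (1 - t) * jacobi_weight \<mu> (\<beta> + 1) t"
        using jacobi_weight_mult_one_minus[of t \<mu> "\<beta> + 1"] by (simp add: add.assoc)
      hence "complex_of_real (jacobi_weight \<mu> (\<beta> + 2) t) = (1 - of_real t) * weight t"
        by (simp only: of_real_mult of_real_diff of_real_1)
      thus ?thesis by (simp only: W1_def) (simp add: algebra_simps)
    qed
    show ?thesis unfolding split dilation_integral_def
      by (intro Bochner_Integration.integral_diff dilation_integral_integrable W.holomorphic weight_unit_weight
            unit_weight_jacobi) (use mu_pos beta_gt in auto)
  qed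
  finally have dG: "deriv G 0 = deriv P 0 * (dilation_integral P weight l -
      dilation_integral P (\<lambda>t. of_real (jacobi_weight \<mu> (\<beta> + 2) t)) l)" .
  show ?thesis using diff unfolding dilation_integral_cmult G0 dG by (simp add: algebra_simps)
qed

text \<open>
  The function on the left vanishes at every zero by the preceding lemma, so Hardy's argument applies
  a second time.
\<close>

lemma integral_equation:
  "dilation_integral P weight z + z * dilation_integral P (\<lambda>t. deriv P 0 * of_real (jacobi_weight \<mu> (\<beta> + 2) t)) z =
    of_real (Beta \<mu> (\<beta> + 1)) * P z"
proof -
  have "dilation_integral P weight 0 = of_real (Beta \<mu> (\<beta> + 1))"
    using moment_jacobi_weight[of \<mu> "\<beta> + 1" 0] mu_pos beta_gt by (simp add: dilation_integral_def P_0)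
  moreover have "unit_weight (\<lambda>t. deriv P 0 * of_real (jacobi_weight \<mu> (\<beta> + 2) t))"
    using mu_pos beta_gt by (intro unit_weight_cmult unit_weight_jacobi) auto
  ultimately show ?thesis
    using dilation_integrals_vanishing_at_zeros[OF weight_unit_weight _ mP deriv_P_lam_nonzero vanishing_combination, of z] by simp
qed

definition taylor_coeff :: "nat \<Rightarrow> complex" where "taylor_coeff k = (deriv ^^ k) P 0 / fact k"

lemma taylor_coeff_sums: "(\<lambda>k. taylor_coeff k * z ^ k) sums P z"
  unfolding taylor_coeff_def by (rule entire_taylor_sums(1)[OF W.holomorphic])

lemma taylor_coeff_0: "taylor_coeff 0 = 1"
  by (simp add: taylor_coeff_def P_0)

text \<open>
  Compare the coefficients of \<open>z ^ Suc k\<close> in the integral equation.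
\<close>

lemma taylor_coeff_recurrence:
  "taylor_coeff (Suc k) * of_real (Beta \<mu> (\<beta> + 1) - Beta (\<mu> + real (Suc k)) (\<beta> + 1)) =
     deriv P 0 * taylor_coeff k * of_real (Beta (\<mu> + real k) (\<beta> + 2))"
proof -
  define L where "L z = dilation_integral P weight z +
      z * dilation_integral P (\<lambda>t. deriv P 0 * of_real (jacobi_weight \<mu> (\<beta> + 2) t)) z" for z
  (* The factor \<open>z\<close> shifts the coefficients of the second integral by one. *)
  define b where "b k = (if k = 0 then 0 else deriv P 0 * taylor_coeff (k - 1) * of_real (Beta (\<mu> + real (k - 1)) (\<beta> + 2)))" for k
  have s0: "(\<lambda>k. taylor_coeff k * of_real (Beta (\<mu> + real k) (\<beta> + 1)) * z ^ k) sums dilation_integral P weight z" for z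
    using dilation_integral_sums[OF weight_unit_weight W.holomorphic, of z] mu_pos beta_gt
    by (simp only: moment_jacobi_weight taylor_coeff_def)
  have s1: "(\<lambda>k. b k * z ^ k) sums
      (z * dilation_integral P (\<lambda>t. deriv P 0 * of_real (jacobi_weight \<mu> (\<beta> + 2) t)) z)" for z
  proof -
    have u: "unit_weight (\<lambda>t. complex_of_real (jacobi_weight \<mu> (\<beta> + 2) t))"
      using mu_pos beta_gt by (intro unit_weight_jacobi) auto
    have m: "(\<integral>t. of_real (t ^ k) * complex_of_real (jacobi_weight \<mu> (\<beta> + 2) t) \<partial>lborel) =
        of_real (Beta (\<mu> + real k) (\<beta> + 2))" for k
      using mu_pos beta_gt by (intro moment_jacobi_weight) auto
    have "(\<lambda>k. (z * deriv P 0) * (taylor_coeff k * of_real (Beta (\<mu> + real k) (\<beta> + 2)) * z ^ k)) sums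
       ((z * deriv P 0) * dilation_integral P (\<lambda>t. of_real (jacobi_weight \<mu> (\<beta> + 2) t)) z)"
      using dilation_integral_sums[OF u W.holomorphic, of z] unfolding m taylor_coeff_def[symmetric] by (rule sums_mult)
    hence "(\<lambda>k. b (Suc k) * z ^ Suc k) sums
       (z * dilation_integral P (\<lambda>t. deriv P 0 * of_real (jacobi_weight \<mu> (\<beta> + 2) t)) z)"
      by (simp add: b_def dilation_integral_cmult mult_ac)
    thus ?thesis by (subst (asm) sums_Suc_iff) (simp add: b_def)
  qed
  have "(\<lambda>k. (taylor_coeff k * of_real (Beta (\<mu> + real k) (\<beta> + 1)) + b k) * z ^ k) sums L z" for z
    using sums_add[OF s0[of z] s1[of z]] by (simp add: L_def distrib_right)
  from entire_power_series(2)[OF this] have 1: "taylor_coeff k * of_real (Beta (\<mu> + real k) (\<beta> + 1)) + b k = (deriv ^^ k) L 0 / fact k" for k .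
  have "(\<lambda>k. (of_real (Beta \<mu> (\<beta> + 1)) * taylor_coeff k) * z ^ k) sums L z" for z
    unfolding L_def integral_equation mult.assoc by (intro sums_mult taylor_coeff_sums)
  from entire_power_series(2)[OF this] have 2: "of_real (Beta \<mu> (\<beta> + 1)) * taylor_coeff k = (deriv ^^ k) L 0 / fact k" for k .
  have "taylor_coeff (Suc k) * of_real (Beta (\<mu> + real (Suc k)) (\<beta> + 1)) + b (Suc k) = of_real (Beta \<mu> (\<beta> + 1)) * taylor_coeff (Suc k)"
    using 1[of "Suc k"] 2[of "Suc k"] by simp
  thus ?thesis by (simp add: b_def algebra_simps)
qed

lemma taylor_coeff_eq: "taylor_coeff n = of_real (Gamma \<mu>) * series_coeff \<mu> \<beta> (deriv P 0) n"
proof (induction n)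
  case 0
  thus ?case using Gamma_real_pos[OF mu_pos] by (simp add: taylor_coeff_0 series_coeff_0)
next
  case (Suc n)
  define B X Y m where "B = Beta \<mu> (\<beta> + 1)" and "X = pochhammer \<mu> (Suc n)"
    and "Y = pochhammer (\<mu> + \<beta> + 1) (Suc n)" and "m = \<mu> + real n"
  have m: "m > 0" using mu_pos by (simp add: m_def)
  have X: "X > 0" using mu_pos by (simp add: X_def pochhammer_pos)
  have XY: "X < Y" unfolding X_def Y_def using mu_pos beta_gt by (intro pochhammer_strict_mono) auto
  have B: "B > 0" using mu_pos beta_gt by (simp add: B_def Beta_def Gamma_real_pos)
  have 1: "Beta (\<mu> + real (Suc n)) (\<beta> + 1) = B * X / Y"
    using Beta_plus_nat[of \<mu> "\<beta> + 1" "Suc n"] mu_pos beta_gt by (simp only: B_def X_def Y_def) (simp add: add_ac)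
  have 2: "Beta (\<mu> + real n) (\<beta> + 2) = B * (\<beta> + 1) * X / (Y * m)"
    using Beta_plus_nat_plus_one[of \<mu> "\<beta> + 1" n] mu_pos beta_gt by (simp only: B_def X_def Y_def m_def) (simp add: add_ac)
  have 3: "B - B * X / Y = B * (Y - X) / Y" using X XY by (simp add: field_simps)
  have "taylor_coeff (Suc n) * of_real (B * (Y - X) / Y) = deriv P 0 * taylor_coeff n * of_real (B * (\<beta> + 1) * X / (Y * m))"
    using taylor_coeff_recurrence[of n] unfolding 1 2 B_def[symmetric] 3 .
  hence "taylor_coeff (Suc n) = deriv P 0 * taylor_coeff n * of_real (B * (\<beta> + 1) * X / (Y * m)) / of_real (B * (Y - X) / Y)"
    using B X XY by (intro eq_divide_imp) auto
  also have "\<dots> = deriv P 0 * taylor_coeff n * of_real (B * (\<beta> + 1) * X / (Y * m) / (B * (Y - X) / Y))"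
    by simp
  also have "B * (\<beta> + 1) * X / (Y * m) / (B * (Y - X) / Y) = (\<beta> + 1) * (X / (Y - X) / m)"
  proof -
    have "B * b * X / (Y * m) / (B * D / Y) = b * (X / D / m)" if "D \<noteq> 0" for b D
      using B X XY m that by (simp add: field_simps)
    from this[of "Y - X"] show ?thesis using XY by simp
  qed
  finally show ?case
    unfolding series_coeff_Suc[OF mu_pos] X_def[symmetric] Y_def[symmetric] m_def[symmetric] Suc.IH
    by (simp add: mult_ac)
qed

text \<open>
  If the derivative vanished, the closed form of the coefficients would make \<open>P\<close> the constant \<open>1\<close>,
  which has no zeros.
\<close>

lemma deriv_P_nonzero: "deriv P 0 \<noteq> 0"
proof
  assume "deriv P 0 = 0"
  hence "taylor_coeff n = 0" if "n > 0" for n using that by (simp add: taylor_coeff_eq series_coeff_def)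
  hence "(\<lambda>k. taylor_coeff k * of_real (lam 0) ^ k) sums 1"
    using sums_finite[of "{0}" "\<lambda>k. taylor_coeff k * of_real (lam 0) ^ k"] taylor_coeff_0 by simp
  hence "P (of_real (lam 0)) = 1" using taylor_coeff_sums sums_unique2 by blast
  moreover have "P (of_real (lam 0)) = 0" using W.zero by auto
  ultimately show False by simp
qed

end

section \<open>The order of the series\<close>

lemma ln_affine_powr_over_ln_tendsto:
  fixes a b p :: real
  assumes "b > 0" "p > 0"
  shows "((\<lambda>r. ln (a + b * r powr p) / ln r) \<longlongrightarrow> p) at_top"
  using assms by real_asymp

text \<open>
  With \<open>s = x powr (1 / \<sigma>)\<close> the terms are \<open>(s ^ n / fact n) powr \<sigma>\<close>. For \<open>\<sigma> \<ge> 1\<close> the sum of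
  \<open>\<sigma>\<close>-th powers is at most the \<open>\<sigma>\<close>-th power of the sum, which is \<open>exp s powr \<sigma>\<close>.
\<close>

lemma sums_power_over_fact_powr_le:
  fixes x \<sigma> :: real
  assumes x: "x \<ge> 0" and \<sigma>: "\<sigma> \<ge> 1"
  shows "summable (\<lambda>n. x ^ n / fact n powr \<sigma>)"
    and "(\<Sum>n. x ^ n / fact n powr \<sigma>) \<le> exp (\<sigma> * x powr (1 / \<sigma>))"
proof -
  define s where "s = x powr (1 / \<sigma>)"
  have s: "s \<ge> 0" by (simp add: s_def)
  have exps: "(\<lambda>n. s ^ n / fact n) sums exp s"
    using exp_converges[of s] by (simp add: divide_inverse mult.commute)
  have le: "x ^ n / fact n powr \<sigma> \<le> exp (s * (\<sigma> - 1)) * (s ^ n / fact n)" for n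
  proof (cases "x = 0 \<and> n > 0")
    case True
    thus ?thesis using s by (simp add: zero_power)
  next
    case False
    define q where "q = s ^ n / fact n"
    have q: "q \<ge> 0" using s by (simp add: q_def)
    have "(s ^ n) powr \<sigma> = x ^ n"
    proof (cases "n = 0")
      case n: False
      hence "x > 0" using False x by auto
      hence "s powr real n = s ^ n" "x powr real n = x ^ n" by (simp_all add: s_def powr_realpow)
      moreover have "(s powr real n) powr \<sigma> = x powr real n" using \<sigma> by (simp add: s_def powr_powr)
      ultimately show ?thesis by simp
    qed simp
    hence "x ^ n / fact n powr \<sigma> = q powr \<sigma>" using s by (simp add: q_def powr_divide)
    also have "q powr \<sigma> = q powr (\<sigma> - 1) * q"
    proof (cases "q = 0")
      case False
      thus ?thesis using q powr_add[of q "\<sigma> - 1" 1] by simp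
    qed simp
    also have "\<dots> \<le> exp s powr (\<sigma> - 1) * q"
    proof -
      have "q \<le> (\<Sum>n. s ^ n / fact n)"
        unfolding q_def using sum_le_suminf[OF sums_summable[OF exps], of "{n}"] s by simp
      hence "q \<le> exp s" using exps by (simp add: sums_iff)
      thus ?thesis using q \<sigma> by (intro mult_right_mono powr_mono2) auto
    qed
    also have "exp s powr (\<sigma> - 1) = exp (s * (\<sigma> - 1))" by (simp add: powr_def mult.commute)
    finally show ?thesis by (simp add: q_def)
  qed
  have s2: "(\<lambda>n. exp (s * (\<sigma> - 1)) * (s ^ n / fact n)) sums (exp (s * (\<sigma> - 1)) * exp s)"
    by (rule sums_mult[OF exps])
  show summ: "summable (\<lambda>n. x ^ n / fact n powr \<sigma>)"
    by (rule summable_comparison_test'[OF sums_summable[OF s2], of 0]) (use le x in simp)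
  have "(\<Sum>n. x ^ n / fact n powr \<sigma>) \<le> exp (s * (\<sigma> - 1)) * exp s"
    using suminf_le[OF le summ sums_summable[OF s2]] s2 by (simp add: sums_iff)
  also have "\<dots> = exp (\<sigma> * s)" by (simp add: algebra_simps flip: exp_add)
  finally show "(\<Sum>n. x ^ n / fact n powr \<sigma>) \<le> exp (\<sigma> * x powr (1 / \<sigma>))" by (simp add: s_def)
qed

text \<open>
  With \<open>s = x powr (1 / \<sigma>)\<close> and \<open>n\<close> the integer part of \<open>s / 2\<close> one has
  \<open>fact n \<le> n ^ n \<le> (s / 2) ^ n\<close>, so the term \<open>(s ^ n / fact n) powr \<sigma>\<close> is at least \<open>2 powr (\<sigma> * n)\<close>.
\<close>

lemma exists_large_term_power_over_fact_powr:
  fixes x \<sigma> :: real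
  assumes x: "x > 0" and \<sigma>: "\<sigma> > 0"
  shows "\<exists>n. x ^ n / fact n powr \<sigma> \<ge> exp (\<sigma> * ln 2 * (x powr (1 / \<sigma>) / 2 - 1))"
proof -
  define s where "s = x powr (1 / \<sigma>)"
  have s: "s > 0" using x by (simp add: s_def)
  define n where "n = nat \<lfloor>s / 2\<rfloor>"
  have n: "real n \<le> s / 2" "s / 2 - 1 \<le> real n" using s by (simp_all add: n_def) linarith
  have "fact n \<le> (real n) ^ n" using fact_le_power[of n, where 'a = real] by simp
  also have "\<dots> \<le> (s / 2) ^ n" using n by (intro power_mono) auto
  finally have f: "fact n \<le> (s / 2) ^ n" .
  hence "2 ^ n * fact n \<le> s ^ n" by (simp add: power_divide field_simps)
  hence "2 ^ n \<le> s ^ n / fact n" by (simp add: field_simps)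
  hence "(2 ^ n) powr \<sigma> \<le> (s ^ n / fact n) powr \<sigma>" using \<sigma> by (intro powr_mono2) auto
  also have "\<dots> = (s ^ n) powr \<sigma> / fact n powr \<sigma>" using s by (simp add: powr_divide)
  also have "(s ^ n) powr \<sigma> = x ^ n"
    using x s \<sigma> by (simp add: powr_realpow[symmetric] powr_powr s_def)
  finally have "(2 ^ n) powr \<sigma> \<le> x ^ n / fact n powr \<sigma>" .
  moreover have "(2 ^ n) powr \<sigma> = exp (\<sigma> * ln 2 * real n)"
    by (simp add: powr_def ln_realpow mult_ac)
  moreover have "exp (\<sigma> * ln 2 * (s / 2 - 1)) \<le> exp (\<sigma> * ln 2 * real n)"
    using n \<sigma> by simp
  ultimately show ?thesis unfolding s_def[symmetric] by (intro exI[of _ n]) linarith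
qed

text \<open>
  The two preceding estimates, combined with Cauchy's inequality, place \<open>ln (max_modulus g r)\<close>
  between two functions of the form \<open>const + const * r powr (1 / \<sigma>)\<close>.
\<close>

theorem entire_order_power_series:
  fixes c :: "nat \<Rightarrow> complex"
  assumes \<sigma>: "\<sigma> \<ge> 1" and pos: "A > 0" "k > 0" "B > 0" "K > 0"
    and lower: "\<And>n. A * k ^ n / fact n powr \<sigma> \<le> norm (c n)"
    and upper: "\<And>n. norm (c n) \<le> B * K ^ n / fact n powr \<sigma>"
  shows "summable (\<lambda>n. c n * z ^ n)"
    and "entire_order (\<lambda>z. \<Sum>n. c n * z ^ n) = ereal (1 / \<sigma>)"
proof -
  define g where "g z = (\<Sum>n. c n * z ^ n)" for z
  have term_le: "norm (c n * z ^ n) \<le> B * ((K * norm z) ^ n / fact n powr \<sigma>)" for n z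
    using mult_right_mono[OF upper[of n], of "norm z ^ n"] by (simp add: norm_mult norm_power power_mult_distrib)
  have summ: "summable (\<lambda>n. B * ((K * norm z) ^ n / fact n powr \<sigma>))" for z :: complex
    using pos \<sigma> by (intro summable_mult sums_power_over_fact_powr_le) auto
  have nsum: "summable (\<lambda>n. norm (c n * z ^ n))" for z
    by (rule summable_comparison_test'[OF summ[of z], of 0]) (use term_le in simp)
  show sumc: "summable (\<lambda>n. c n * z ^ n)" for z by (rule summable_norm_cancel[OF nsum])
  have sums: "(\<lambda>n. c n * z ^ n) sums g z" for z unfolding g_def by (rule summable_sums[OF sumc])
  have hol: "g holomorphic_on UNIV" by (rule entire_power_series(1)[OF sums])
  define L where "L r = ln A - \<sigma> * ln 2 + (\<sigma> * ln 2 * k powr (1 / \<sigma>) / 2) * r powr (1 / \<sigma>)" for r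
  define U where "U r = ln B + (\<sigma> * K powr (1 / \<sigma>)) * r powr (1 / \<sigma>)" for r
  have up: "max_modulus g r \<le> exp (U r)" if r: "r > 0" for r
  proof (rule max_modulus_le)
    fix z :: complex assume z: "norm z = r"
    have "norm (g z) \<le> (\<Sum>n. norm (c n * z ^ n))" unfolding g_def by (rule summable_norm[OF nsum])
    also have "\<dots> \<le> (\<Sum>n. B * ((K * norm z) ^ n / fact n powr \<sigma>))"
      by (rule suminf_le[OF term_le nsum summ])
    also have "\<dots> = B * (\<Sum>n. (K * norm z) ^ n / fact n powr \<sigma>)"
      using pos \<sigma> by (intro suminf_mult sums_power_over_fact_powr_le) auto
    also have "\<dots> \<le> B * exp (\<sigma> * (K * norm z) powr (1 / \<sigma>))"
      using pos \<sigma> by (intro mult_left_mono sums_power_over_fact_powr_le) auto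
    also have "\<dots> = exp (U r)" using pos r by (simp add: U_def exp_add z powr_mult mult_ac)
    finally show "norm (g z) \<le> exp (U r)" .
  qed (use r in simp)
  have low: "max_modulus g r \<ge> exp (L r)" if r: "r > 0" for r
  proof -
    obtain n where n: "(k * r) ^ n / fact n powr \<sigma> \<ge> exp (\<sigma> * ln 2 * ((k * r) powr (1 / \<sigma>) / 2 - 1))"
      using exists_large_term_power_over_fact_powr[of "k * r" \<sigma>] pos r \<sigma> by auto
    have "exp (L r) = A * exp (\<sigma> * ln 2 * ((k * r) powr (1 / \<sigma>) / 2 - 1))"
    proof -
      have "L r = ln A + \<sigma> * ln 2 * ((k * r) powr (1 / \<sigma>) / 2 - 1)"
        using pos r by (simp add: L_def powr_mult algebra_simps)
      thus ?thesis using pos by (simp add: exp_add)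
    qed
    also have "\<dots> \<le> A * ((k * r) ^ n / fact n powr \<sigma>)" using n pos by (intro mult_left_mono) auto
    also have "\<dots> = (A * k ^ n / fact n powr \<sigma>) * r ^ n" by (simp add: power_mult_distrib)
    also have "\<dots> \<le> norm (c n) * r ^ n" using lower r by (intro mult_right_mono) auto
    also have "c n = (deriv ^^ n) g 0 / fact n" by (rule entire_power_series(2)[OF sums])
    also have "norm \<dots> * r ^ n \<le> max_modulus g r" by (rule taylor_coeff_le_max_modulus[OF hol r])
    finally show ?thesis .
  qed
  have limL: "((\<lambda>r. ln (L r) / ln r) \<longlongrightarrow> 1 / \<sigma>) at_top" unfolding L_def
    using pos \<sigma> by (intro ln_affine_powr_over_ln_tendsto) auto
  have limU: "((\<lambda>r. ln (U r) / ln r) \<longlongrightarrow> 1 / \<sigma>) at_top" unfolding U_def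
    using pos \<sigma> by (intro ln_affine_powr_over_ln_tendsto) auto
  have "filterlim L at_top at_top"
  proof -
    define b where "b = \<sigma> * ln 2 * k powr (1 / \<sigma>) / 2"
    define p where "p = 1 / \<sigma>"
    have "b > 0" "p > 0" using pos \<sigma> by (auto simp: b_def p_def)
    hence "filterlim (\<lambda>r. (ln A - \<sigma> * ln 2) + b * r powr p) at_top at_top" by real_asymp
    thus ?thesis by (simp add: L_def[abs_def] b_def p_def)
  qed
  hence Lpos: "eventually (\<lambda>r. L r > 0) at_top" by (rule filterlim_at_top_dense[THEN iffD1, rule_format])
  have ineq: "eventually (\<lambda>r. ln (L r) / ln r \<le> ln (ln (max_modulus g r)) / ln r \<and>
      ln (ln (max_modulus g r)) / ln r \<le> ln (U r) / ln r) at_top"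
    using Lpos eventually_gt_at_top[of 1]
  proof eventually_elim
    case (elim r)
    have M: "max_modulus g r > 0" using low[of r] elim by (smt (verit) exp_gt_zero)
    have 1: "L r \<le> ln (max_modulus g r)" using low[of r] elim M by (simp add: ln_ge_iff)
    have 2: "ln (max_modulus g r) \<le> U r" using up[of r] elim M by (metis ln_exp ln_le_cancel_iff exp_gt_zero less_trans zero_less_one)
    have "ln (L r) \<le> ln (ln (max_modulus g r))" "ln (ln (max_modulus g r)) \<le> ln (U r)"
      using 1 2 elim by simp_all
    thus ?case using elim by (auto intro!: divide_right_mono)
  qed
  have "((\<lambda>r. ln (ln (max_modulus g r)) / ln r) \<longlongrightarrow> 1 / \<sigma>) at_top"
    by (rule tendsto_sandwich[OF _ _ limL limU]) (use ineq in \<open>auto elim: eventually_mono\<close>)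
  hence "((\<lambda>r. ereal (ln (ln (max_modulus g r)) / ln r)) \<longlongrightarrow> ereal (1 / \<sigma>)) at_top"
    by (rule tendsto_ereal)
  hence "entire_order g = ereal (1 / \<sigma>)"
    unfolding entire_order_def by (intro lim_imp_Limsup) auto
  thus "entire_order (\<lambda>z. \<Sum>n. c n * z ^ n) = ereal (1 / \<sigma>)" by (simp add: g_def[abs_def])
qed

lemma pos_convergent_bounds:
  fixes R :: "nat \<Rightarrow> real"
  assumes pos: "\<And>n. R n > 0" and lim: "R \<longlonglongrightarrow> l" and l: "l > 0"
  obtains k K where "k > 0" "K > 0" "\<And>n. k \<le> R n" "\<And>n. R n \<le> K"
proof -
  have "Bseq R" using lim convergentI convergent_imp_Bseq by blast
  then obtain K where K: "K > 0" "\<And>n. norm (R n) \<le> K" by (auto simp: Bseq_def)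
  have "(\<lambda>n. inverse (R n)) \<longlonglongrightarrow> inverse l" using lim l by (intro tendsto_inverse) auto
  hence "Bseq (\<lambda>n. inverse (R n))" using convergentI convergent_imp_Bseq by blast
  then obtain D where D: "D > 0" "\<And>n. norm (inverse (R n)) \<le> D" by (auto simp: Bseq_def)
  have "1 / D \<le> R n" for n using D(2)[of n] D(1) pos[of n] by (simp add: field_simps)
  thus ?thesis using that[of "1 / D" K] D(1) K by (simp add: abs_of_pos pos)
qed

text \<open>
  Gauss's limit formula for \<open>Gamma\<close>, applied to numerator and denominator.
\<close>

lemma pochhammer_quotient_asymptotics:
  fixes p q :: real
  assumes p: "p > 0" and q: "q > 0"
  shows "(\<lambda>n. pochhammer (p + q) (Suc n) / pochhammer p (Suc n) / real n powr q) \<longlonglongrightarrow> Gamma p / Gamma (p + q)"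
proof -
  have ni: "x \<notin> \<int>\<^sub>\<le>\<^sub>0" if "x > 0" for x :: real
    using that nonpos_Ints_nonpos[of x] by auto
  have G: "Gamma x > 0" if "x > 0" for x :: real using Gamma_real_pos[OF that] .
  have "(\<lambda>n. Gamma_series p n / Gamma_series (p + q) n) \<longlonglongrightarrow> Gamma p / Gamma (p + q)"
    using G[of "p + q"] p q by (intro tendsto_intros) (simp add: less_imp_neq[symmetric])
  moreover have "eventually (\<lambda>n. Gamma_series p n / Gamma_series (p + q) n =
     pochhammer (p + q) (Suc n) / pochhammer p (Suc n) / real n powr q) sequentially"
    using eventually_gt_at_top[of 0]
  proof eventually_elim
    case (elim n)
    have "pochhammer p (Suc n) > 0" "pochhammer (p + q) (Suc n) > 0"
      using p q by (auto intro!: pochhammer_pos)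
    thus ?case using elim
      by (simp add: Gamma_series_def powr_def distrib_right exp_add del: pochhammer_Suc)
  qed
  ultimately show ?thesis by (simp add: Lim_transform_eventually)
qed

text \<open>
  The quotient of consecutive coefficients, multiplied by \<open>Suc n powr (\<beta> + 2)\<close>, is positive and has a
  positive limit, so it lies between two positive constants \<open>k\<close> and \<open>K\<close>. Telescoping turns the factors
  \<open>Suc n powr (\<beta> + 2)\<close> into the power of the factorial.
\<close>

theorem series_coeff_bounds:
  assumes mu: "\<mu> > 0" and beta: "\<beta> > - 1" and a: "a \<noteq> 0"
  obtains A k B K where "A > 0" "k > 0" "B > 0" "K > 0"
    "\<And>n. A * k ^ n / fact n powr (\<beta> + 2) \<le> norm (series_coeff \<mu> \<beta> a n)"
    "\<And>n. norm (series_coeff \<mu> \<beta> a n) \<le> B * K ^ n / fact n powr (\<beta> + 2)"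
proof -
  define \<sigma> where "\<sigma> = \<beta> + 2"
  define X Y where "X n = pochhammer \<mu> (Suc n)" and "Y n = pochhammer (\<mu> + (\<beta> + 1)) (Suc n)" for n
  define q where "q n = norm a * (\<beta> + 1) * (X n / (Y n - X n) / (\<mu> + real n))" for n
  define R where "R n = q n * real (Suc n) powr \<sigma>" for n
  have X: "X n > 0" for n using mu by (simp add: X_def pochhammer_pos)
  have XY: "X n < Y n" for n unfolding X_def Y_def using mu beta by (intro pochhammer_strict_mono) auto
  have m: "\<mu> + real n > 0" for n using mu by simp
  have q_pos: "q n > 0" for n
    unfolding q_def using X XY[of n] m a beta by (intro mult_pos_pos divide_pos_pos) auto
  hence R_pos: "R n > 0" for n by (simp add: R_def)
  have step: "norm (series_coeff \<mu> \<beta> a (Suc n)) = norm (series_coeff \<mu> \<beta> a n) * q n" for n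
  proof -
    have "norm (of_real (X n / (Y n - X n) / (\<mu> + real n)) :: complex) = X n / (Y n - X n) / (\<mu> + real n)"
      using X[of n] XY[of n] m[of n] by (simp only: norm_of_real abs_of_pos divide_pos_pos diff_gt_0_iff_gt)
    moreover have "norm (of_real (\<beta> + 1) :: complex) = \<beta> + 1" using beta by (simp only: norm_of_real abs_of_pos)
    ultimately show ?thesis
      unfolding series_coeff_Suc[OF mu] q_def norm_mult add.assoc[of \<mu> \<beta> 1] X_def[symmetric] Y_def[symmetric]
      by simp
  qed
  define \<rho> where "\<rho> = Gamma \<mu> / Gamma (\<mu> + (\<beta> + 1))"
  have \<rho>: "\<rho> > 0" using mu beta by (simp add: \<rho>_def Gamma_real_pos)
  have lim\<rho>: "(\<lambda>n. Y n / X n / real n powr (\<beta> + 1)) \<longlonglongrightarrow> \<rho>"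
    unfolding X_def Y_def \<rho>_def using mu beta by (intro pochhammer_quotient_asymptotics) auto
  have "R \<longlonglongrightarrow> norm a * (\<beta> + 1) * (1 / (\<rho> - 0) * 1)"
  proof -
    have l1: "(\<lambda>n. real n powr - (\<beta> + 1)) \<longlonglongrightarrow> 0" using beta by real_asymp
    (* \<open>R n\<close> is written in terms of \<open>Y n / X n\<close>, which grows like \<open>\<rho> * n powr (\<beta> + 1)\<close>. *)
    have l2: "(\<lambda>n. real (Suc n) powr (\<beta> + 2) / (real n powr (\<beta> + 1) * (\<mu> + real n))) \<longlonglongrightarrow> 1"
      using beta by real_asymp
    have "(\<lambda>n. norm a * (\<beta> + 1) * (1 / (Y n / X n / real n powr (\<beta> + 1) - real n powr - (\<beta> + 1)) *
       (real (Suc n) powr (\<beta> + 2) / (real n powr (\<beta> + 1) * (\<mu> + real n))))) \<longlonglongrightarrow> norm a * (\<beta> + 1) * (1 / (\<rho> - 0) * 1)"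
      by (intro tendsto_intros lim\<rho> l1 l2) (use \<rho> in auto)
    moreover have "eventually (\<lambda>n. norm a * (\<beta> + 1) * (1 / (Y n / X n / real n powr (\<beta> + 1) - real n powr - (\<beta> + 1)) *
       (real (Suc n) powr (\<beta> + 2) / (real n powr (\<beta> + 1) * (\<mu> + real n)))) = R n) sequentially"
      using eventually_gt_at_top[of 0]
    proof eventually_elim
      case (elim n)
      define N where "N = real n powr (\<beta> + 1)"
      have N: "N > 0" using elim by (simp add: N_def)
      have "Y n / X n / N - real n powr - (\<beta> + 1) = (Y n - X n) / (X n * N)"
      proof -
        have "real n powr - (\<beta> + 1) = 1 / N" unfolding N_def powr_minus by (simp add: divide_inverse)
        thus ?thesis using X[of n] N by (simp add: field_simps)
      qed
      moreover have "1 / ((Y n - X n) / (X n * N)) * (S / (N * (\<mu> + real n))) = X n / (Y n - X n) / (\<mu> + real n) * S" for S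
        using X[of n] N by simp
      ultimately show ?case unfolding N_def[symmetric] by (simp add: R_def q_def \<sigma>_def mult.assoc)
    qed
    ultimately show ?thesis by (simp add: Lim_transform_eventually)
  qed
  moreover have "norm a * (\<beta> + 1) * (1 / (\<rho> - 0) * 1) > 0" using a beta \<rho> by simp
  ultimately obtain k K where kK: "k > 0" "K > 0" "\<And>n. k \<le> R n" "\<And>n. R n \<le> K"
    using pos_convergent_bounds[of R] R_pos by metis
  define A where "A = norm (series_coeff \<mu> \<beta> a 0)"
  have A: "A > 0" using Gamma_real_pos[OF mu] by (simp add: A_def series_coeff_0)
  have exact: "norm (series_coeff \<mu> \<beta> a n) = A * (\<Prod>i<n. R i) / fact n powr \<sigma>" for n
  proof (induction n)
    case 0 show ?case by (simp add: A_def)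
  next
    case (Suc n)
    have "fact (Suc n) powr \<sigma> = real (Suc n) powr \<sigma> * fact n powr \<sigma>"
      by (simp add: powr_mult del: of_nat_Suc)
    thus ?case unfolding step Suc.IH by (simp add: R_def)
  qed
  have "k ^ n \<le> (\<Prod>i<n. R i)" for n
    using prod_mono[of "{..<n}" "\<lambda>_. k" R] kK by simp
  moreover have "(\<Prod>i<n. R i) \<le> K ^ n" for n
    using prod_mono[of "{..<n}" R "\<lambda>_. K"] kK R_pos by (simp add: less_imp_le)
  ultimately show ?thesis
    using A kK by (intro that[of A k A K]) (auto simp: exact \<sigma>_def[symmetric] intro!: divide_right_mono mult_left_mono)
qed

section \<open>The Bessel case\<close>

lemma series_coeff_beta_0:
  assumes mu: "\<mu> > 0"
  shows "series_coeff \<mu> 0 a n = (a * of_real \<mu>) ^ n / (fact n * of_real (Gamma (\<mu> + real n)))"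
proof (induction n)
  case 0
  thus ?case by (simp add: series_coeff_0)
next
  case (Suc n)
  define p where "p = pochhammer (\<mu> + 1) n"
  have p: "p > 0" using mu by (simp add: p_def pochhammer_pos)
  have "pochhammer \<mu> (Suc n) = \<mu> * p" by (simp add: p_def pochhammer_rec)
  moreover have "pochhammer (\<mu> + 0 + 1) (Suc n) = p * (\<mu> + 1 + real n)" by (simp add: p_def pochhammer_Suc)
  ultimately have "pochhammer (\<mu> + 0 + 1) (Suc n) - pochhammer \<mu> (Suc n) = p * real (Suc n)"
    "pochhammer \<mu> (Suc n) = \<mu> * p" by (simp_all add: algebra_simps)
  hence quot: "pochhammer \<mu> (Suc n) / (pochhammer (\<mu> + 0 + 1) (Suc n) - pochhammer \<mu> (Suc n)) / (\<mu> + real n)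
      = \<mu> / (real (Suc n) * (\<mu> + real n))" using p by simp
  have "\<mu> + real n \<notin> \<int>\<^sub>\<le>\<^sub>0" using mu nonpos_Ints_nonpos[of "\<mu> + real n"] by auto
  from Gamma_plus1[OF this] have G: "Gamma (\<mu> + real (Suc n)) = (\<mu> + real n) * Gamma (\<mu> + real n)"
    by (simp add: add_ac)
  have "series_coeff \<mu> 0 a (Suc n) = series_coeff \<mu> 0 a n * (a * of_real (\<mu> / (real (Suc n) * (\<mu> + real n))))"
    unfolding series_coeff_Suc[OF mu] quot by simp
  also have "\<dots> = (a * of_real \<mu>) ^ Suc n / (fact (Suc n) * of_real (Gamma (\<mu> + real (Suc n))))"
    unfolding Suc.IH G by (simp add: mult_ac)
  finally show ?case .
qed

lemma bessel_series_eq_series_coeff: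
  assumes mu: "\<mu> > 0" and u: "u\<^sup>2 = - 4 * a * of_real \<mu> * z"
  shows "bessel_series (of_real (\<mu> - 1)) u = (\<Sum>n. series_coeff \<mu> 0 a n * z ^ n)"
  unfolding bessel_series_def
proof (rule suminf_cong)
  fix n :: nat
  have "(u / 2) ^ (2 * n) = (- (a * of_real \<mu> * z)) ^ n"
    by (simp add: power_mult power_divide u mult.assoc)
  hence 1: "(- 1) ^ n * (u / 2) ^ (2 * n) = (a * of_real \<mu>) ^ n * z ^ n"
    by (simp flip: power_mult_distrib)
  have "complex_of_real (\<mu> - 1) + of_nat n + 1 = of_real (\<mu> + real n)" by simp
  hence 2: "rGamma (complex_of_real (\<mu> - 1) + of_nat n + 1) = 1 / of_real (Gamma (\<mu> + real n))"
    by (simp only: rGamma_inverse_Gamma Gamma_complex_of_real) (simp add: divide_inverse)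
  have "(- 1) ^ n * rGamma (complex_of_real (\<mu> - 1) + of_nat n + 1) / fact n * (u / 2) ^ (2 * n) =
      ((- 1) ^ n * (u / 2) ^ (2 * n)) * (rGamma (complex_of_real (\<mu> - 1) + of_nat n + 1) / fact n)"
    by simp
  also have "\<dots> = series_coeff \<mu> 0 a n * z ^ n"
    unfolding 1 2 series_coeff_beta_0[OF mu] by simp
  finally show "(- 1) ^ n * rGamma (complex_of_real (\<mu> - 1) + of_nat n + 1) / fact n * (u / 2) ^ (2 * n) =
      series_coeff \<mu> 0 a n * z ^ n" .
qed

text \<open>
  All powers of \<open>z\<close> are exponentials of multiples of the same \<open>Ln z\<close>, and
  \<open>(\<mu> - 1) / 2 - \<alpha> / 2 = \<nu>\<close>.
\<close>

lemma powr_mult_bessel_J_log: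
  assumes mu: "\<mu> > 0" "\<mu> = 2 * \<nu> + \<alpha> + 1" and c: "c \<noteq> 0" "c\<^sup>2 = - 4 * a * of_real \<mu>" and z: "z \<noteq> 0"
  shows "z powr of_real (- \<alpha> / 2) * bessel_J_log (of_real (\<mu> - 1)) (Ln c + Ln z / 2) =
    exp (of_real (\<mu> - 1) * (Ln c - Ln 2)) * (z powr of_real \<nu> * (\<Sum>n. series_coeff \<mu> 0 a n * z ^ n))"
proof -
  define m where "m = complex_of_real (\<mu> - 1)"
  have "(exp (Ln c + Ln z / 2))\<^sup>2 = exp (Ln c) ^ 2 * exp (Ln z)"
    by (simp add: exp_add power_mult_distrib flip: exp_double)
  also have "\<dots> = - 4 * a * of_real \<mu> * z" using c z by simp
  finally have series: "bessel_series m (exp (Ln c + Ln z / 2)) = (\<Sum>n. series_coeff \<mu> 0 a n * z ^ n)"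
    unfolding m_def by (rule bessel_series_eq_series_coeff[OF mu(1)])
  have "of_real (- \<alpha> / 2) * Ln z + m * (Ln c + Ln z / 2 - Ln 2) = m * (Ln c - Ln 2) + of_real \<nu> * Ln z"
    by (simp add: m_def mu(2) field_simps)
  hence "exp (of_real (- \<alpha> / 2) * Ln z) * exp (m * (Ln c + Ln z / 2 - Ln 2)) =
      exp (m * (Ln c - Ln 2)) * exp (of_real \<nu> * Ln z)" by (metis exp_add)
  thus ?thesis using z unfolding bessel_J_log_def m_def[symmetric] series by (simp add: powr_def)
qed

text \<open>
  A number \<open>c\<close> off the negative axis with real square is positive or purely imaginary, so its argument is
  at most \<open>pi / 2\<close> in modulus. The argument of the square root of \<open>z\<close> lies in the half-open interval from
  \<open>- pi / 2\<close> to \<open>pi / 2\<close>; the sum is still a principal argument.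
\<close>

lemma Ln_mult_sqrt:
  assumes c: "c \<notin> \<real>\<^sub>\<le>\<^sub>0" "c\<^sup>2 \<in> \<real>" and z: "z \<noteq> 0"
  shows "Ln (c * z powr (1 / 2)) = Ln c + Ln z / 2"
proof (rule Ln_unique)
  have c0: "c \<noteq> 0" using c by auto
  show "exp (Ln c + Ln z / 2) = c * z powr (1 / 2)"
    using c0 z by (simp add: exp_add powr_def)
  have "Re c * Im c = 0" using c(2) by (auto simp: complex_is_Real_iff power2_eq_square)
  hence "Re c \<ge> 0" using c(1) by (auto simp: complex_nonpos_Reals_iff not_le)
  hence "\<bar>Im (Ln c)\<bar> \<le> pi / 2" using Re_Ln_pos_le[OF c0] by simp
  moreover have "- pi < Im (Ln z)" "Im (Ln z) \<le> pi" using mpi_less_Im_Ln[OF z] Im_Ln_le_pi[OF z] by auto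
  ultimately show "- pi < Im (Ln c + Ln z / 2)" "Im (Ln c + Ln z / 2) \<le> pi" by auto
qed

text \<open>
  The condition on \<open>c\<^sup>2\<close> holds for \<open>c\<^sup>2 = - 4 * a * \<mu>\<close> because \<open>F\<close>, and with it \<open>a = F'(0)\<close>, is real
  on the real line.
\<close>

lemma bessel_J_eq_log_sqrt:
  assumes "c \<notin> \<real>\<^sub>\<le>\<^sub>0" "c\<^sup>2 \<in> \<real>" "z \<noteq> 0"
  shows "bessel_J \<kappa> (c * z powr (1 / 2)) = bessel_J_log \<kappa> (Ln c + Ln z / 2)"
proof -
  have "c * z powr (1 / 2) \<noteq> 0" using assms by auto
  thus ?thesis using Ln_mult_sqrt[OF assms] by (simp add: bessel_J_eq_log)
qed

section \<open>Solutions of the orthogonality problem\<close>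

theorem theorem2:
  fixes \<nu> \<alpha> \<beta> \<mu> :: real
    and f F :: "complex \<Rightarrow> complex"
    and lam :: "nat \<Rightarrow> real"
    and a :: complex
  assumes alpha: "\<alpha> > - 1 - 2 * \<nu>"
    and beta: "\<beta> > - 1"
    and B: "class_B \<nu> f F lam"
    and orth: "\<And>n m. n \<noteq> m \<Longrightarrow>
      ((\<lambda>t. f (complex_of_real (lam n * t)) * f (complex_of_real (lam m * t)) *
            complex_of_real (t powr \<alpha> * (1 - t) powr \<beta>)) has_integral 0) {0..1}"
    and a: "a = deriv F 0"
    and mu: "\<mu> = 2 * \<nu> + \<alpha> + 1"
  shows "(\<exists>C. \<forall>z. z \<noteq> 0 \<longrightarrow>
            f z = C * z powr complex_of_real \<nu> * (\<Sum>n. series_coeff \<mu> \<beta> a n * z ^ n)) \<and>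
         (\<forall>z. summable (\<lambda>n. series_coeff \<mu> \<beta> a n * z ^ n)) \<and>
         (\<lambda>z. \<Sum>n. series_coeff \<mu> \<beta> a n * z ^ n) holomorphic_on UNIV \<and>
         entire_order (\<lambda>z. \<Sum>n. series_coeff \<mu> \<beta> a n * z ^ n) = ereal (1 / (\<beta> + 2)) \<and>
         1 / (\<beta> + 2) < 1 \<and>
         (\<beta> = 0 \<longrightarrow> (\<forall>c. c\<^sup>2 = - 4 * a * complex_of_real \<mu> \<longrightarrow>
            (\<exists>C'. \<forall>z. z \<noteq> 0 \<longrightarrow>
               f z = C' * z powr complex_of_real (- \<alpha> / 2) *
                     bessel_J_log (complex_of_real (\<mu> - 1)) (Ln c + Ln z / 2) \<and>
               (c \<notin> \<real>\<^sub>\<le>\<^sub>0 \<longrightarrow>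
                  f z = C' * z powr complex_of_real (- \<alpha> / 2) *
                        bessel_J (complex_of_real (\<mu> - 1)) (c * z powr (1 / 2))))))"
proof -
  have f: "\<And>z. z \<noteq> 0 \<Longrightarrow> f z = z powr complex_of_real \<nu> * F z"
    and holF: "F holomorphic_on UNIV" and F0: "F 0 = 1"
    and growth: "entire_order F < 1 \<or> entire_order F = 1 \<and> entire_type 1 F = 0"
    and enum: "real_zero_enum F lam" and summ: "summable (\<lambda>n. 1 / \<bar>lam n\<bar>)"
    using B by (auto simp: class_B_def)
  have mu_pos: "\<mu> > 0" using alpha mu by simp
  have lam_nz: "lam n \<noteq> 0" for n
    using enum F0 unfolding real_zero_enum_def by (metis of_real_0 zero_neq_one)
  interpret real_zeros_product lam
    by unfold_locales (use lam_nz summ in auto)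
  have mF: "minimal_exp_type F"
    by (rule order_and_type_imp_minimal_exp_type[OF holF _ growth]) (simp add: F0)
  have FP: "F = P" by (rule hadamard_factorization[OF holF F0 mF enum])
  interpret jacobi_orthogonal_dilations lam \<mu> \<beta>
  proof unfold_locales
    show "minimal_exp_type P" using mF FP by simp
    show "(\<integral>t. P (of_real (lam n) * of_real t) * P (of_real (lam m) * of_real t) *
          of_real (jacobi_weight \<mu> (\<beta> + 1) t) \<partial>lborel) = 0" if "n \<noteq> m" for n m
      using orthogonality_of_entire_factors[OF mu_pos mu beta holF f lam_nz lam_nz orth[OF that]] FP by simp
  qed (use mu_pos beta in auto)
  have aP: "a = deriv P 0" using a FP by simp
  have a_nz: "a \<noteq> 0" and a_real: "a \<in> \<real>" using deriv_P_nonzero deriv_P_real aP by auto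
  have G: "Gamma \<mu> > 0" by (rule Gamma_real_pos[OF mu_pos])
  let ?S = "\<lambda>z. \<Sum>n. series_coeff \<mu> \<beta> a n * z ^ n"
  obtain A k B K where bounds: "A > 0" "k > 0" "B > 0" "K > 0"
    "\<And>n. A * k ^ n / fact n powr (\<beta> + 2) \<le> norm (series_coeff \<mu> \<beta> a n)"
    "\<And>n. norm (series_coeff \<mu> \<beta> a n) \<le> B * K ^ n / fact n powr (\<beta> + 2)"
    using series_coeff_bounds[OF mu_pos beta a_nz] by blast
  have b2: "\<beta> + 2 \<ge> 1" using beta by simp
  note series = entire_order_power_series[OF b2 bounds]
  have F_eq: "F z = of_real (Gamma \<mu>) * ?S z" for z
  proof -
    have "(\<lambda>n. of_real (Gamma \<mu>) * (series_coeff \<mu> \<beta> a n * z ^ n)) sums P z"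
      using taylor_coeff_sums[of z] by (simp add: taylor_coeff_eq aP mult.assoc)
    moreover have "(\<lambda>n. of_real (Gamma \<mu>) * (series_coeff \<mu> \<beta> a n * z ^ n)) sums (of_real (Gamma \<mu>) * ?S z)"
      by (intro sums_mult summable_sums series(1))
    ultimately show ?thesis using FP sums_unique2 by metis
  qed
  have f_eq: "f z = of_real (Gamma \<mu>) * z powr complex_of_real \<nu> * ?S z" if "z \<noteq> 0" for z
    using f[OF that] F_eq[of z] by simp
  have bessel: "\<exists>C'. \<forall>z. z \<noteq> 0 \<longrightarrow>
               f z = C' * z powr complex_of_real (- \<alpha> / 2) *
                     bessel_J_log (complex_of_real (\<mu> - 1)) (Ln c + Ln z / 2) \<and>
               (c \<notin> \<real>\<^sub>\<le>\<^sub>0 \<longrightarrow>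
                  f z = C' * z powr complex_of_real (- \<alpha> / 2) *
                        bessel_J (complex_of_real (\<mu> - 1)) (c * z powr (1 / 2)))"
    if b0: "\<beta> = 0" and c: "c\<^sup>2 = - 4 * a * complex_of_real \<mu>" for c
  proof -
    define D where "D = exp (complex_of_real (\<mu> - 1) * (Ln c - Ln 2))"
    have D: "D \<noteq> 0" by (simp add: D_def)
    have "c\<^sup>2 \<noteq> 0" using a_nz mu_pos by (simp add: c)
    hence c_nz: "c \<noteq> 0" by auto
    have c2: "c\<^sup>2 \<in> \<real>" unfolding c using a_real by (intro Reals_mult) auto
    have 1: "f z = of_real (Gamma \<mu>) / D * z powr complex_of_real (- \<alpha> / 2) *
                     bessel_J_log (complex_of_real (\<mu> - 1)) (Ln c + Ln z / 2)" if z: "z \<noteq> 0" for z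
    proof -
      have "of_real (Gamma \<mu>) / D * z powr complex_of_real (- \<alpha> / 2) *
                     bessel_J_log (complex_of_real (\<mu> - 1)) (Ln c + Ln z / 2)
          = of_real (Gamma \<mu>) / D * (z powr complex_of_real (- \<alpha> / 2) *
                     bessel_J_log (complex_of_real (\<mu> - 1)) (Ln c + Ln z / 2))" by (simp only: mult.assoc)
      also have "\<dots> = of_real (Gamma \<mu>) / D * (D * (z powr complex_of_real \<nu> * (\<Sum>n. series_coeff \<mu> 0 a n * z ^ n)))"
        unfolding powr_mult_bessel_J_log[OF mu_pos mu c_nz c z] D_def ..
      also have "\<dots> = f z" using f_eq[OF z] D by (simp add: b0)
      finally show ?thesis ..
    qed
    moreover have "f z = of_real (Gamma \<mu>) / D * z powr complex_of_real (- \<alpha> / 2) *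
                        bessel_J (complex_of_real (\<mu> - 1)) (c * z powr (1 / 2))"
      if "z \<noteq> 0" "c \<notin> \<real>\<^sub>\<le>\<^sub>0" for z
      unfolding bessel_J_eq_log_sqrt[OF that(2) c2 that(1)] by (rule 1[OF that(1)])
    ultimately show ?thesis by blast
  qed
  show ?thesis
  proof (intro conjI allI impI)
    show "\<exists>C. \<forall>z. z \<noteq> 0 \<longrightarrow> f z = C * z powr complex_of_real \<nu> * ?S z" using f_eq by blast
    show "?S holomorphic_on UNIV"
      by (rule entire_power_series(1)[of "series_coeff \<mu> \<beta> a"]) (rule summable_sums[OF series(1)])
    show "1 / (\<beta> + 2) < 1" using beta by simp
  qed (use series bessel in auto)
qed

end
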